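(* Let $0 < \kappa < 1$, $\lambda = \sqrt{1-\kappa^2}$, and let $P_\kappa = \wp(\,\cdot\,; G_2, G_3)$ with $G_2 = 48(1 + 8\kappa^2)$ and $G_3 = 64(1 - 20\kappa^2 - 8\kappa^4)$. The period lattice of $P_\kappa$ is rectangular, generated by $2\Omega_\kappa$ and $2\Omega_\kappa'$ with $\Omega_\kappa > 0$ real and $\Omega_\kappa'$ purely imaginary with positive imaginary part. Then $$\Omega_\kappa' = {\rm i}\, \tfrac{1}{6\sqrt2}\, \pi \,_2F_1 (\tfrac{1}{3}, \tfrac{2}{3}; 1; \lambda^2).$$
   Context: $\wp(\,\cdot\,; g_2, g_3)$ denotes the Weierstrass elliptic function with invariants $g_2, g_3$; $\,_2F_1$ is the Gauss hypergeometric function. *)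

theory Defs
  imports "HOL-Analysis.Analysis"
begin

text \<open>Weierstrass invariants of the lattice generated by 2 w1 and 2 w2
  (w1, w2 half-periods):
  g2 = 60 * sum over nonzero lattice points w of w^(-4),
  g3 = 140 * sum over nonzero lattice points w of w^(-6).
  The Weierstrass function with invariants g2, g3 is the one attached to
  the lattice having these invariants, so "the period lattice of wp(.;G2,G3)
  is generated by 2 w1, 2 w2" means exactly that this lattice has invariants G2, G3.\<close>

definition lattice_g2 :: "complex \<Rightarrow> complex \<Rightarrow> complex" where
  "lattice_g2 w1 w2 = 60 * infsum (\<lambda>(m::int, n::int).
      1 / (2 * of_int m * w1 + 2 * of_int n * w2) ^ 4) (UNIV - {(0, 0)})"

definition lattice_g3 :: "complex \<Rightarrow> complex \<Rightarrow> complex" where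
  "lattice_g3 w1 w2 = 140 * infsum (\<lambda>(m::int, n::int).
      1 / (2 * of_int m * w1 + 2 * of_int n * w2) ^ 6) (UNIV - {(0, 0)})"

definition hyp2F1 :: "real \<Rightarrow> real \<Rightarrow> real \<Rightarrow> real \<Rightarrow> real" where
  "hyp2F1 a b c x = (\<Sum>n. pochhammer a n * pochhammer b n / (pochhammer c n * fact n) * x ^ n)"

end

theory Submission
  imports Defs "HOL-Complex_Analysis.Complex_Analysis"
begin

text \<open>
  On the imaginary axis of a rectangular lattice, \<open>p(u) = - \<wp>(iu)\<close> is real, decreases
  from infinity to a critical value on \<open>(0, t]\<close>, and satisfies \<open>p'\<^sup>2 = 4 p\<^sup>3 - G\<^sub>2 p + G\<^sub>3\<close>. With
  \<open>x = \<lambda>\<^sup>2\<close> and \<open>s = \<surd>(2 x / (p + 6))\<close> this becomes \<open>s' = \<surd>2 \<surd>(x - (3 s - 4 s\<^sup>3)\<^sup>2)\<close>. Since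
  \<open>3 s - 4 s\<^sup>3\<close> triples the angle, \<open>s = sin (z/3)\<close> and \<open>sin z = \<surd>x sin \<theta>\<close> give
  \<open>3 \<surd>2 du = (cos (z/3) / cos z) d\<theta> = F(1/3, 2/3; 1/2; x sin\<^sup>2 \<theta>) d\<theta>\<close> with \<open>\<theta>\<close> running over
  \<open>[0, \<pi>/2]\<close>, and integrating the series termwise yields \<open>(\<pi>/2) F(1/3, 2/3; 1; x)\<close>.

  A rectangular lattice with the given invariants exists by the intermediate value theorem: for the
  half-periods \<open>1, iy\<close> one has \<open>g\<^sub>2 > 0\<close>, the quantity \<open>g\<^sub>3 / g\<^sub>2\<^bsup>3/2\<^esup>\<close> changes sign under
  \<open>y \<mapsto> 1/y\<close> and tends to \<open>1/\<surd>27\<close> as \<open>y\<close> tends to infinity, by the values of the zeta function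
  at 4 and 6.
\<close>

section \<open>The hypergeometric function with parameters 1/3 and 2/3\<close>

text \<open>The shift by 6 comes from points of order three. With these invariants \<wp> takes the
  value 6 there, since 6 is a root of the 3-division polynomial
  \<open>48 X^4 - 24 G2 X^2 - 48 G3 X - G2^2\<close>. Accordingly
  \<open>p'^2 = 4 (p + 6)^3 - 8 (3 (p + 6) - 8 x)^2\<close>, a cube minus a square, and
  \<open>p + 6 = 2 x / s^2\<close> turns the cube into the constant \<open>x\<close> and the square
  into that of the triple-angle polynomial, up to a common factor. Two obstacles shape the
  integration. Both ends of the interval are singular, one by the pole of \<open>p\<close> and the
  other by arcsin at 1, so derivatives are taken in the interior only, the ends enter through
  limits, and no inverse function is formed. Also, the first-order equation alone tells neither at
  which root of the cubic \<open>p\<close> stops nor that \<open>p\<close> is monotone on the way;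
  signs of the cubic and the second-order equation settle this. Existence of the lattice is a
  separate matter: the formula is asserted for every rectangular lattice with these invariants and
  would be vacuous without one.\<close>

definition cubic_coeff :: "nat \<Rightarrow> real" where
  "cubic_coeff n = pochhammer (1/3) n * pochhammer (2/3) n / (pochhammer (1/2) n * fact n)"

lemma cubic_coeff_0 [simp]: "cubic_coeff 0 = 1"
  by (simp add: cubic_coeff_def)

lemma cubic_coeff_Suc:
  "(real n + 1) * (real n + 1/2) * cubic_coeff (Suc n) = (real n + 1/3) * (real n + 2/3) * cubic_coeff n"
proof -
  have "pochhammer (1/2 :: real) n > 0"
    by (intro pochhammer_pos) auto
  thus ?thesis
    by (simp add: cubic_coeff_def pochhammer_Suc divide_simps) (simp add: algebra_simps)
qed

lemma cubic_coeff_pos: "cubic_coeff n > 0"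
  by (simp add: cubic_coeff_def pochhammer_pos)

lemma cubic_coeff_le_1: "cubic_coeff n \<le> 1"
proof (induction n)
  case (Suc n)
  have "(real n + 1) * (real n + 1/2) * cubic_coeff (Suc n) \<le> (real n + 1) * (real n + 1/2) * 1"
    unfolding cubic_coeff_Suc
  proof (rule mult_mono)
    show "(real n + 1/3) * (real n + 2/3) \<le> (real n + 1) * (real n + 1/2)"
      by (simp add: algebra_simps)
  qed (use Suc cubic_coeff_pos[of n] in auto)
  thus ?case by (subst (asm) mult_le_cancel_left_pos) auto
qed simp

lemma summable_cubic_coeff:
  fixes y :: real
  assumes "\<bar>y\<bar> < 1"
  shows "summable (\<lambda>n. cubic_coeff n * y ^ n)"
proof (rule summable_comparison_test)
  show "\<exists>N. \<forall>n\<ge>N. norm (cubic_coeff n * y ^ n) \<le> \<bar>y\<bar> ^ n"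
    using cubic_coeff_le_1 cubic_coeff_pos
    by (auto simp: abs_mult power_abs less_imp_le intro!: mult_left_le_one_le)
  show "summable (\<lambda>n. \<bar>y\<bar> ^ n)" using assms by (intro summable_geometric) auto
qed

definition cubic_series :: "real \<Rightarrow> real" where
  "cubic_series y = (\<Sum>n. cubic_coeff n * y ^ n)"

text \<open>Coefficient by coefficient, the hypergeometric equation with parameters 1/3, 2/3; 1/2 is
  the recurrence \<open>cubic_coeff_Suc\<close>. The derivatives stay anonymous because only the
  equation between them matters.\<close>

lemma cubic_series_ode:
  obtains f1 f2 where
    "\<And>y. \<bar>y\<bar> < 1 \<Longrightarrow> (cubic_series has_real_derivative f1 y) (at y)"
    "\<And>y. \<bar>y\<bar> < 1 \<Longrightarrow> (f1 has_real_derivative f2 y) (at y)"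
    "\<And>y. \<bar>y\<bar> < 1 \<Longrightarrow> y * (1 - y) * f2 y + (1/2 - 2 * y) * f1 y - 2/9 * cubic_series y = 0"
proof -
  define f1 where "f1 y = (\<Sum>n. diffs cubic_coeff n * y ^ n)" for y
  define f2 where "f2 y = (\<Sum>n. diffs (diffs cubic_coeff) n * y ^ n)" for y
  have s0: "summable (\<lambda>n. cubic_coeff n * y ^ n)" if "\<bar>y\<bar> < 1" for y
    by (rule summable_cubic_coeff[OF that])
  have s1: "summable (\<lambda>n. diffs cubic_coeff n * y ^ n)" if "\<bar>y\<bar> < 1" for y
    by (rule termdiff_converges[where K=1]) (use that s0 in auto)
  have s2: "summable (\<lambda>n. diffs (diffs cubic_coeff) n * y ^ n)" if "\<bar>y\<bar> < 1" for y
    by (rule termdiff_converges[where K=1]) (use that s1 in auto)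
  have d1: "(cubic_series has_real_derivative f1 y) (at y)" if "\<bar>y\<bar> < 1" for y
    unfolding cubic_series_def f1_def
    by (rule termdiffs_strong_converges_everywhere termdiffs_strong'[where K=1])
       (use that s0 in auto)
  have d2: "(f1 has_real_derivative f2 y) (at y)" if "\<bar>y\<bar> < 1" for y
    unfolding f1_def f2_def
    by (rule termdiffs_strong'[where K=1]) (use that s1 in auto)
  have ode: "y * (1 - y) * f2 y + (1/2 - 2 * y) * f1 y - 2/9 * cubic_series y = 0"
    if y: "\<bar>y\<bar> < 1" for y
  proof -
    let ?c = cubic_coeff
    have F: "(\<lambda>n. ?c n * y ^ n) sums cubic_series y"
      unfolding cubic_series_def by (rule summable_sums[OF s0[OF y]])
    have F1: "(\<lambda>n. (real n + 1) * ?c (n+1) * y ^ n) sums f1 y"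
      using summable_sums[OF s1[OF y]] by (simp add: f1_def diffs_def add.commute)
    \<comment> \<open>Multiplication by \<open>y\<close> moves the coefficients up one place. This
      expresses \<open>y f1\<close>, \<open>y f2\<close> and \<open>y^2 f2\<close> as series in the
      same powers \<open>y ^ n\<close>.\<close>
    have shift: "g sums (y * l)" if "g 0 = 0" "\<And>n. g (Suc n) = y * h n" "h sums l" for g h l
      using sums_Suc[of g "y * l"] sums_mult[OF that(3), of y] that(1,2) by simp
    have yF1: "(\<lambda>n. real n * ?c n * y ^ n) sums (y * f1 y)"
      by (rule shift[OF _ _ F1]) (auto simp: algebra_simps)
    have F2: "(\<lambda>n. (real n + 1) * (real n + 2) * ?c (n+2) * y ^ n) sums f2 y"
      using summable_sums[OF s2[OF y]] by (simp add: f2_def diffs_def add_ac mult_ac)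
    have yF2: "(\<lambda>n. real n * (real n + 1) * ?c (n+1) * y ^ n) sums (y * f2 y)"
      by (rule shift[OF _ _ F2]) (auto simp: algebra_simps)
    have yyF2: "(\<lambda>n. n * (real n - 1) * ?c n * y ^ n) sums (y * (y * f2 y))"
      by (rule shift[OF _ _ yF2]) (auto simp: algebra_simps)
    have "(\<lambda>n. real n * (real n + 1) * ?c (n+1) * y ^ n - real n * (real n - 1) * ?c n * y ^ n
              + 1/2 * ((real n + 1) * ?c (n+1) * y ^ n) - 2 * (real n * ?c n * y ^ n) - 2/9 * (?c n * y ^ n))
          sums (y * f2 y - y * (y * f2 y) + 1/2 * f1 y - 2 * (y * f1 y) - 2/9 * cubic_series y)"
      by (intro sums_add sums_diff sums_mult F F1 yF1 yF2 yyF2)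
    moreover have "real n * (real n + 1) * ?c (n+1) * y ^ n - real n * (real n - 1) * ?c n * y ^ n
              + 1/2 * ((real n + 1) * ?c (n+1) * y ^ n) - 2 * (real n * ?c n * y ^ n) - 2/9 * (?c n * y ^ n)
          = ((real n + 1) * (real n + 1/2) * ?c (Suc n) - (real n + 1/3) * (real n + 2/3) * ?c n) * y ^ n" for n
    proof -
      have "real n * (real n + 1) * C * Y - real n * (real n - 1) * D * Y
              + 1/2 * ((real n + 1) * C * Y) - 2 * (real n * D * Y) - 2/9 * (D * Y)
          = ((real n + 1) * (real n + 1/2) * C - (real n + 1/3) * (real n + 2/3) * D) * Y" for C D Y :: real
        by (simp add: field_simps)
      thus ?thesis by (simp only: Suc_eq_plus1)
    qed
    ultimately have "(\<lambda>n::nat. 0::real) sums (y * f2 y - y * (y * f2 y) + 1/2 * f1 y - 2 * (y * f1 y) - 2/9 * cubic_series y)"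
      by (simp only: cubic_coeff_Suc diff_self mult_zero_left)
    hence "y * f2 y - y * (y * f2 y) + 1/2 * f1 y - 2 * (y * f1 y) - 2/9 * cubic_series y = 0"
      using sums_unique2 sums_zero by blast
    thus ?thesis by (simp add: algebra_simps)
  qed
  show thesis by (rule that[OF d1 d2 ode])
qed

lemma abs_sin_less_1: "\<bar>sin z\<bar> < 1" if "\<bar>z\<bar> < pi/2" for z :: real
proof -
  have "cos z > 0" using that by (intro cos_gt_zero_pi) auto
  hence "(sin z)\<^sup>2 < 1" using sin_cos_squared_add[of z] by (smt (verit) zero_less_power)
  thus ?thesis by (simp add: abs_square_less_1)
qed

text \<open>The difference \<open>h\<close> of the two sides satisfies \<open>h'' = - h / 9\<close>,
  which is the hypergeometric equation pulled back along \<open>y = sin^2 z\<close>. Since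
  \<open>h\<close> and its derivative \<open>h1\<close> vanish at 0, the energy
  \<open>e = h1^2 + h^2 / 9\<close> is constantly 0.\<close>

lemma cubic_series_sin:
  fixes z :: real
  assumes z: "\<bar>z\<bar> < pi / 2"
  shows "cubic_series ((sin z)\<^sup>2) * cos z = cos (z / 3)"
proof -
  obtain f1 f2 where
    d1: "\<And>y. \<bar>y\<bar> < 1 \<Longrightarrow> (cubic_series has_real_derivative f1 y) (at y)" and
    d2: "\<And>y. \<bar>y\<bar> < 1 \<Longrightarrow> (f1 has_real_derivative f2 y) (at y)" and
    ode: "\<And>y. \<bar>y\<bar> < 1 \<Longrightarrow> y * (1 - y) * f2 y + (1/2 - 2 * y) * f1 y - 2/9 * cubic_series y = 0"
    using cubic_series_ode by blast
  let ?f = cubic_series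
  define h where "h z = ?f ((sin z)\<^sup>2) * cos z - cos (z/3)" for z
  define h1 where "h1 z = 2 * sin z * (cos z)\<^sup>2 * f1 ((sin z)\<^sup>2) - sin z * ?f ((sin z)\<^sup>2) + sin (z/3) / 3" for z
  have s1: "\<bar>(sin z)\<^sup>2\<bar> < 1" if "\<bar>z\<bar> < pi/2" for z :: real
    using abs_sin_less_1[OF that] by (simp add: abs_square_less_1)
  have third: "((\<lambda>z. cos (z/3)) has_real_derivative - sin (z/3) / 3) (at z)"
    "((\<lambda>z. sin (z/3) / 3) has_real_derivative cos (z/3) / 9) (at z)" for z :: real
    by (auto intro!: derivative_eq_intros)
  have dh: "(h has_real_derivative h1 z) (at z)" if "\<bar>z\<bar> < pi/2" for z
    unfolding h_def h1_def
    by (rule third derivative_eq_intros DERIV_chain2[OF d1] s1 that refl)+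
       (simp add: algebra_simps power2_eq_square)
  have dh1: "(h1 has_real_derivative - h z / 9) (at z)" if "\<bar>z\<bar> < pi/2" for z
  proof -
    let ?s = "sin z" and ?c = "cos z" and ?y = "(sin z)\<^sup>2"
    have "(h1 has_real_derivative
        (2 * ?c * ?c\<^sup>2 - 4 * ?s\<^sup>2 * ?c) * f1 ?y + 2 * ?s * ?c\<^sup>2 * (f2 ?y * (2 * ?s * ?c))
         - ?c * ?f ?y - ?s * (f1 ?y * (2 * ?s * ?c)) + cos (z/3) / 9) (at z)"
      unfolding h1_def
      by (rule third derivative_eq_intros DERIV_chain2[OF d1] DERIV_chain2[OF d2] s1 that refl)+
         (simp add: algebra_simps power2_eq_square)
    moreover have "(2 * ?c * ?c\<^sup>2 - 4 * ?s\<^sup>2 * ?c) * f1 ?y + 2 * ?s * ?c\<^sup>2 * (f2 ?y * (2 * ?s * ?c))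
         - ?c * ?f ?y - ?s * (f1 ?y * (2 * ?s * ?c)) + cos (z/3) / 9 = - h z / 9"
    proof -
      have c: "?c\<^sup>2 = 1 - ?y" by (simp add: cos_squared_eq)
      have "(2 * ?c * ?c\<^sup>2 - 4 * ?s\<^sup>2 * ?c) * f1 ?y + 2 * ?s * ?c\<^sup>2 * (f2 ?y * (2 * ?s * ?c))
         - ?c * ?f ?y - ?s * (f1 ?y * (2 * ?s * ?c)) + cos (z/3) / 9
         = 4 * ?c * (?y * (1 - ?y) * f2 ?y + (1/2 - 2 * ?y) * f1 ?y - 2/9 * ?f ?y)
           - ?c * ?f ?y / 9 + cos (z/3) / 9"
        unfolding c by (simp add: field_simps power2_eq_square power4_eq_xxxx)
      also have "\<dots> = - h z / 9" unfolding ode[OF s1[OF that]] h_def by (simp add: field_simps)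
      finally show ?thesis .
    qed
    ultimately show ?thesis by simp
  qed
  define e where "e z = (h1 z)\<^sup>2 + (h z)\<^sup>2 / 9" for z
  have de: "(e has_real_derivative 0) (at z)" if "\<bar>z\<bar> < pi/2" for z
  proof -
    have "(e has_real_derivative 2 * h1 z * (- h z / 9) + 1/9 * (2 * h z * h1 z)) (at z)"
      unfolding e_def
      by (auto intro!: derivative_eq_intros dh dh1 that)
    thus ?thesis by simp
  qed
  have "\<exists>c. \<forall>z\<in>{-(pi/2)<..<pi/2}. e z = c"
  proof (rule has_field_derivative_zero_constant [of "{-(pi/2)<..<pi/2}" e, unfolded Ball_def[symmetric]])
    show "convex {-(pi/2)<..<pi/2}" by simp
    show "(e has_field_derivative 0) (at x within {- (pi / 2)<..<pi / 2})"
      if "x \<in> {- (pi / 2)<..<pi / 2}" for x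
      by (rule has_field_derivative_at_within[OF de]) (use that in auto)
  qed
  moreover have "z \<in> {-(pi/2)<..<pi/2}" "0 \<in> {-(pi/2)<..<pi/2}"
    using z abs_less_iff[of z "pi/2"] by auto
  ultimately have "e z = e 0" by metis
  also have "e 0 = 0"
    by (simp add: e_def h_def h1_def cubic_series_def)
  finally have "h z = 0" by (simp add: e_def add_nonneg_eq_0_iff)
  thus ?thesis by (simp add: h_def)
qed

text \<open>Wallis integral. The induction step integrates the derivative of
  \<open>sin^(2n+1) cos\<close>, a function that vanishes at both ends of the interval.\<close>

lemma has_integral_sin_even_power:
  "((\<lambda>\<theta>. sin \<theta> ^ (2 * n)) has_integral pi / 2 * (pochhammer (1/2) n / fact n)) {0..pi/2}"
proof (induction n)
  case 0
  show ?case using has_integral_const_real[of "1::real" 0 "pi/2"] by simp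
next
  case (Suc n)
  let ?G = "\<lambda>\<theta>::real. sin \<theta> ^ (2 * n + 1) * cos \<theta>"
  have "((\<lambda>\<theta>. (2 * n + 1) * sin \<theta> ^ (2 * n) - (2 * n + 2) * sin \<theta> ^ (2 * Suc n)) has_integral
            (?G (pi/2) - ?G 0)) {0..pi/2}"
  proof (rule fundamental_theorem_of_calculus)
    fix \<theta> :: real
    have "(?G has_real_derivative (2 * n + 1) * sin \<theta> ^ (2 * n) * cos \<theta> * cos \<theta> - sin \<theta> ^ (2*n+1) * sin \<theta>) (at \<theta>)"
      by (rule derivative_eq_intros refl)+ simp
    also have "(2 * n + 1) * sin \<theta> ^ (2 * n) * cos \<theta> * cos \<theta> - sin \<theta> ^ (2*n+1) * sin \<theta> =
        (2 * n + 1) * sin \<theta> ^ (2 * n) - (2 * n + 2) * sin \<theta> ^ (2 * Suc n)"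
    proof -
      have "cos \<theta> * cos \<theta> = 1 - sin \<theta> * sin \<theta>"
        using sin_cos_squared_add[of \<theta>] by (simp add: power2_eq_square)
      hence *: "r * cos \<theta> * cos \<theta> = r * (1 - sin \<theta> * sin \<theta>)" for r
        by (simp only: mult.assoc)
      show ?thesis unfolding * by (simp add: algebra_simps)
    qed
    finally show "(?G has_vector_derivative (2 * n + 1) * sin \<theta> ^ (2 * n) - (2 * n + 2) * sin \<theta> ^ (2 * Suc n))
        (at \<theta> within {0..pi/2})"
      unfolding has_real_derivative_iff_has_vector_derivative[symmetric]
      by (rule has_field_derivative_at_within)
  qed simp
  hence "((\<lambda>\<theta>. (2 * n + 1) * sin \<theta> ^ (2 * n) - (2 * n + 2) * sin \<theta> ^ (2 * Suc n)) has_integral 0) {0..pi/2}"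
    by simp
  from has_integral_diff[OF has_integral_mult_right[OF Suc, of "2 * n + 1"] this]
  have "((\<lambda>\<theta>. (2 * n + 2) * sin \<theta> ^ (2 * Suc n)) has_integral
          (2 * n + 1) * (pi / 2 * (pochhammer (1/2) n / fact n))) {0..pi/2}"
    by (simp add: algebra_simps)
  from has_integral_mult_right[OF this, of "1 / (2 * n + 2)"]
  have "((\<lambda>\<theta>. sin \<theta> ^ (2 * Suc n)) has_integral
          (1 / (2 * n + 2) * ((2 * n + 1) * (pi / 2 * (pochhammer (1/2) n / fact n))))) {0..pi/2}"
    by (simp add: divide_simps)
  also have "(1 / (2 * n + 2) * ((2 * n + 1) * (pi / 2 * (pochhammer (1/2) n / fact n)))) =
       pi / 2 * (pochhammer (1/2) (Suc n) / fact (Suc n))"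
    by (simp add: pochhammer_Suc divide_simps)
  finally show ?case .
qed

text \<open>The Wallis factor cancels \<open>pochhammer (1/2) n\<close> in
  \<open>cubic_coeff n\<close> and leaves a second \<open>fact n\<close>, which changes the lower
  parameter from 1/2 to 1. The majorant \<open>x ^ n\<close> justifies termwise integration.\<close>

lemma has_integral_hyp2F1:
  fixes x :: real
  assumes x: "0 \<le> x" "x < 1"
  shows "((\<lambda>\<theta>. cubic_series (x * (sin \<theta>)\<^sup>2)) has_integral pi / 2 * hyp2F1 (1/3) (2/3) 1 x) {0..pi/2}"
proof -
  define f where "f n \<theta> = cubic_coeff n * (x * (sin \<theta>)\<^sup>2) ^ n" for n and \<theta> :: real
  define I where "I n = pi / 2 * (pochhammer (1/3) n * pochhammer (2/3) n / (pochhammer 1 n * fact n) * x ^ n)" for n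
  have fI: "(f n has_integral I n) {0..pi/2}" for n
  proof -
    have "(f n has_integral (cubic_coeff n * x ^ n) * (pi / 2 * (pochhammer (1/2) n / fact n))) {0..pi/2}"
      using has_integral_mult_right[OF has_integral_sin_even_power[of n], of "cubic_coeff n * x ^ n"]
      by (simp add: f_def[abs_def] power_mult_distrib mult_ac flip: power_mult)
    also have "(cubic_coeff n * x ^ n) * (pi / 2 * (pochhammer (1/2) n / fact n)) = I n"
    proof -
      have "pochhammer (1/2 :: real) n > 0" by (intro pochhammer_pos) auto
      thus ?thesis by (simp add: I_def cubic_coeff_def pochhammer_fact mult_ac)
    qed
    finally show ?thesis .
  qed
  have ul: "uniform_limit (cbox 0 (pi/2)) (\<lambda>n \<theta>. \<Sum>i<n. f i \<theta>) (\<lambda>\<theta>. \<Sum>i. f i \<theta>) sequentially"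
  proof (rule Weierstrass_m_test)
    show "norm (f n \<theta>) \<le> x ^ n" for n \<theta>
    proof -
      have "(x * (sin \<theta>)\<^sup>2) ^ n \<le> x ^ n"
        using x by (intro power_mono mult_left_le) (auto simp: abs_square_le_1)
      moreover have "cubic_coeff n * (x * (sin \<theta>)\<^sup>2) ^ n \<le> 1 * (x * (sin \<theta>)\<^sup>2) ^ n"
        using x by (intro mult_right_mono cubic_coeff_le_1) auto
      ultimately show ?thesis using cubic_coeff_pos[of n] x by (simp add: f_def)
    qed
    show "summable (\<lambda>n. x ^ n)" using x by (intro summable_geometric) auto
  qed
  have ps: "((\<lambda>\<theta>. \<Sum>i<n. f i \<theta>) has_integral (\<Sum>i<n. I i)) (cbox 0 (pi/2))" for n
    using fI by (intro has_integral_sum) auto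
  have int: "(\<lambda>\<theta>. \<Sum>i<n. f i \<theta>) integrable_on cbox 0 (pi/2)" for n
    using ps has_integral_integrable by blast
  obtain J K where JK: "\<And>n. ((\<lambda>\<theta>. \<Sum>i<n. f i \<theta>) has_integral J n) (cbox 0 (pi/2))"
     "((\<lambda>\<theta>. \<Sum>i. f i \<theta>) has_integral K) (cbox 0 (pi/2))" "J \<longlonglongrightarrow> K"
  proof (rule uniform_limit_integral_cbox[OF ul])
    show "continuous_on (cbox 0 (pi/2)) (\<lambda>\<theta>. \<Sum>i<n. f i \<theta>)" for n
      unfolding f_def by (intro continuous_intros)
  qed (auto intro: that)
  have "J n = (\<Sum>i<n. I i)" for n using JK(1) ps has_integral_unique by blast
  hence "J = (\<lambda>n. \<Sum>i<n. I i)" by blast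
  hence "I sums K" using JK(3) by (simp only: sums_def)
  hence "K = (\<Sum>n. I n)" by (rule sums_unique)
  also have "\<dots> = pi / 2 * hyp2F1 (1/3) (2/3) 1 x"
    unfolding I_def hyp2F1_def
  proof (rule suminf_mult)
    have "summable (\<lambda>n. 2 / pi * I n)" using \<open>I sums K\<close> by (intro summable_mult sums_summable)
    thus "summable (\<lambda>n. pochhammer (1/3) n * pochhammer (2/3) n / (pochhammer 1 n * fact n) * x ^ n)"
      by (simp add: I_def mult_ac)
  qed
  finally have "K = pi / 2 * hyp2F1 (1/3) (2/3) 1 x" .
  thus ?thesis using JK(2) unfolding f_def cubic_series_def by (simp only: cbox_interval)
qed

section \<open>The half-period integral\<close>

text \<open>The difference quotient is \<open>3 - 4 (a^2 + a b + b^2)\<close>, and the bracket is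
  below 3/4. The bound 1/2 is where the triple-angle polynomial has its maximum 1, so it delimits
  the branch used below.\<close>

lemma cubic_chebyshev_strict_mono:
  fixes a b :: real
  assumes "0 \<le> a" "a < b" "b \<le> 1/2"
  shows "3 * a - 4 * a ^ 3 < 3 * b - 4 * b ^ 3"
proof -
  have "a * a \<le> 1/4" "a * b \<le> 1/4" "b * b \<le> 1/4" "a * a < 1/4"
    using assms mult_mono[of a "1/2" a "1/2"] mult_mono[of a "1/2" b "1/2"] mult_mono[of b "1/2" b "1/2"]
      mult_strict_mono[of a "1/2" a "1/2"] by auto
  hence "0 < (b - a) * (3 - 4 * (a * a + a * b + b * b))" using assms by simp
  also have "\<dots> = (3 * b - 4 * b ^ 3) - (3 * a - 4 * a ^ 3)"
    by (simp add: algebra_simps power3_eq_cube)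
  finally show ?thesis by simp
qed

lemma sin_triple: "sin (3 * a) = 3 * sin a - 4 * sin a ^ 3" for a :: real
proof -
  have "sin (3 * a) = sin (2 * a + a)" by simp
  also have "\<dots> = 2 * sin a * cos a * cos a + (1 - 2 * (sin a)\<^sup>2) * sin a"
    by (simp only: sin_add sin_double cos_double_sin)
  also have "\<dots> = 2 * sin a * (cos a)\<^sup>2 + (1 - 2 * (sin a)\<^sup>2) * sin a"
    by (simp add: power2_eq_square)
  also have "\<dots> = 3 * sin a - 4 * sin a ^ 3"
    by (simp only: cos_squared_eq) (simp add: algebra_simps power2_eq_square power3_eq_cube)
  finally show ?thesis .
qed

lemma cos_triple: "cos (3 * a) = cos a * (1 - 4 * (sin a)\<^sup>2)" for a :: real
proof -
  have "cos (3 * a) = cos (2 * a + a)" by simp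
  also have "\<dots> = (1 - 2 * (sin a)\<^sup>2) * cos a - 2 * sin a * cos a * sin a"
    by (simp only: cos_add sin_double cos_double_sin)
  also have "\<dots> = cos a * (1 - 4 * (sin a)\<^sup>2)"
    by (simp add: algebra_simps power2_eq_square)
  finally show ?thesis .
qed

text \<open>With \<open>s = sin a\<close> and \<open>a < pi/6\<close> the argument is
  \<open>sin^2 (3 a)\<close>, and \<open>cos (3 a) = cos a (1 - 4 s^2)\<close>. The factor
  \<open>cos a\<close> then cancels in \<open>cubic_series_sin\<close>.\<close>

lemma cubic_series_chebyshev:
  fixes s :: real
  assumes "0 \<le> s" "s < 1/2"
  shows "cubic_series ((3 * s - 4 * s ^ 3)\<^sup>2) = 1 / (1 - 4 * s\<^sup>2)"
proof -
  define a where "a = arcsin s"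
  have s: "sin a = s" unfolding a_def using assms by (intro sin_arcsin) auto
  have "arcsin s < arcsin (1/2)" using assms by (intro arcsin_less_arcsin) auto
  also have "arcsin (1/2::real) = pi/6"
    using arcsin_sin[of "pi/6"] pi_gt_zero by (simp add: sin_30)
  finally have a: "a < pi/6" by (simp add: a_def)
  have a0: "0 \<le> a" unfolding a_def using assms arcsin_le_arcsin[of 0 s] by simp
  have "\<bar>3 * a\<bar> < pi/2" using a a0 by simp
  from cubic_series_sin[OF this]
  have *: "cubic_series ((3 * s - 4 * s ^ 3)\<^sup>2) * (cos a * (1 - 4 * s\<^sup>2)) = cos a"
    by (simp add: sin_triple cos_triple s)
  have "cos a > 0" using a a0 pi_gt_zero by (intro cos_gt_zero_pi) auto
  hence "cubic_series ((3 * s - 4 * s ^ 3)\<^sup>2) * (1 - 4 * s\<^sup>2) = 1" using * by simp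
  moreover have "s\<^sup>2 < (1/2)\<^sup>2" using assms by (intro power_strict_mono) auto
  ultimately show ?thesis by (simp add: eq_divide_eq power2_eq_square)
qed

text \<open>In terms of \<open>v = 1 / s^2\<close> the right-hand side is
  \<open>32 x^2 (x v^3 - (3 v - 4)^2)\<close>, which is the left-hand side at
  \<open>p = 2 x v - 6\<close>.\<close>

lemma weierstrass_cubic_eq:
  fixes x s :: real
  assumes "s \<noteq> 0" and "p = 2 * x / s\<^sup>2 - 6"
  shows "4 * p ^ 3 - 48 * (9 - 8 * x) * p + 64 * (36 * x - 27 - 8 * x\<^sup>2)
           = 32 * x\<^sup>2 / s ^ 6 * (x - (3 * s - 4 * s ^ 3)\<^sup>2)"
proof -
  define v where "v = 1 / s\<^sup>2"
  have p: "p = 2 * x * v - 6" by (simp add: assms v_def)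
  have v: "s\<^sup>2 * v = 1" using assms by (simp add: v_def)
  have "32 * x\<^sup>2 / s ^ 6 * (x - (3 * s - 4 * s ^ 3)\<^sup>2) = 32 * x\<^sup>2 * v ^ 3 * (x - s\<^sup>2 * (3 - 4 * s\<^sup>2)\<^sup>2)"
    by (simp add: v_def power_divide power_mult[symmetric])
       (simp add: algebra_simps power2_eq_square power3_eq_cube)
  also have "\<dots> = 32 * x\<^sup>2 * (x * v ^ 3 - (s\<^sup>2 * v) * (3 * v - 4 * (s\<^sup>2 * v))\<^sup>2)"
    by (simp add: algebra_simps power2_eq_square power3_eq_cube)
  also have "\<dots> = 4 * p ^ 3 - 48 * (9 - 8 * x) * p + 64 * (36 * x - 27 - 8 * x\<^sup>2)"
    unfolding v p by (simp add: algebra_simps power2_eq_square power3_eq_cube)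
  finally show ?thesis ..
qed

text \<open>Stated for a bare real function, so that no lattice enters. The second-order equation
  serves to make \<open>p1\<close> increasing, and the pole at 0 fixes the constant of integration.
  That \<open>t\<close> is the first critical point is not assumed but derived.\<close>

lemma half_period_eq_hyp2F1:
  fixes p p1 :: "real \<Rightarrow> real" and x t :: real
  defines "Q \<equiv> \<lambda>y. 4 * y ^ 3 - 48 * (9 - 8 * x) * y + 64 * (36 * x - 27 - 8 * x\<^sup>2)"
  assumes x: "0 < x" "x < 1" and t: "0 < t"
    and dp: "\<And>u. 0 < u \<Longrightarrow> u \<le> t \<Longrightarrow> (p has_real_derivative p1 u) (at u)"
    and dp1: "\<And>u. 0 < u \<Longrightarrow> u \<le> t \<Longrightarrow> (p1 has_real_derivative 6 * (p u)\<^sup>2 - 24 * (9 - 8 * x)) (at u)"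
    and ode: "\<And>u. 0 < u \<Longrightarrow> u \<le> t \<Longrightarrow> (p1 u)\<^sup>2 = Q (p u)"
    and lim: "filterlim p at_top (at_right 0)"
    and p1t: "p1 t = 0"
  shows "t = pi / (6 * sqrt 2) * hyp2F1 (1/3) (2/3) 1 x"
proof -
  \<comment> \<open>The root of \<open>3 s - 4 s ^ 3 = sqrt x\<close> in \<open>(0, 1/2)\<close>,
    found by trisecting an angle. The value \<open>p0\<close> belonging to it is the largest root of
    \<open>Q\<close>.\<close>
  define s0 where "s0 = sin (arcsin (sqrt x) / 3)"
  have sx: "0 < sqrt x" "sqrt x < 1" using x by auto
  have asx: "0 < arcsin (sqrt x)" "arcsin (sqrt x) < pi/2"
    using arcsin_less_arcsin[of 0 "sqrt x"] arcsin_less_arcsin[of "sqrt x" 1] sx by auto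
  have s0: "0 < s0" "s0 < 1/2"
  proof -
    show "0 < s0" unfolding s0_def using asx by (intro sin_gt_zero) auto
    have "s0 < sin (pi/6)" unfolding s0_def using asx by (intro sin_monotone_2pi) auto
    thus "s0 < 1/2" by (simp add: sin_30)
  qed
  have T0: "3 * s0 - 4 * s0 ^ 3 = sqrt x"
  proof -
    have "sin (arcsin (sqrt x)) = sqrt x" using sx by (intro sin_arcsin) linarith+
    thus ?thesis using sin_triple[of "arcsin (sqrt x) / 3"] by (simp add: s0_def)
  qed
  define p0 where "p0 = 2 * x / s0\<^sup>2 - 6"
  define S where "S y = sqrt (2 * x / (y + 6))" for y
  have S: "0 < S y" "y = 2 * x / (S y)\<^sup>2 - 6" if "y > -6" for y
    using that x by (simp_all add: S_def)
  have S_less: "S y < S z" if "-6 < z" "z < y" for y z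
    using that x unfolding S_def by (intro real_sqrt_less_mono divide_strict_left_mono) auto
  have p0_6: "p0 > -6" using s0 x by (simp add: p0_def)
  have Sp0: "S p0 = s0" using s0 x by (simp add: S_def p0_def)
  \<comment> \<open>The value \<open>8 * x - 6\<close> corresponds to \<open>s = 1/2\<close>, the
    end of the monotone branch; between it and \<open>p0\<close> the cubic \<open>Q\<close> is
    negative.\<close>
  have half6: "8 * x - 6 > -6" using x by simp
  have "2 * x / (8 * x - 6 + 6) = (1/2)\<^sup>2" using x by (simp add: power2_eq_square)
  hence Shalf: "S (8 * x - 6) = 1/2" by (simp only: S_def real_sqrt_abs)
  have p0_half: "8 * x - 6 < p0"
  proof (rule ccontr)
    assume "\<not> ?thesis"
    hence "p0 < 8 * x - 6 \<or> p0 = 8 * x - 6" by auto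
    thus False using S_less[OF p0_6, of "8 * x - 6"] s0 Sp0 Shalf by auto
  qed
  have Q_eq: "Q y = 32 * x\<^sup>2 / S y ^ 6 * (x - (3 * S y - 4 * S y ^ 3)\<^sup>2)" if "y > -6" for y
    unfolding Q_def by (rule weierstrass_cubic_eq) (use S[OF that] in auto)
  have T_nonneg: "0 \<le> 3 * s - 4 * s ^ 3" if "0 \<le> s" "s \<le> 1/2" for s :: real
    using that cubic_chebyshev_strict_mono[of 0 s] by (cases "s = 0") auto
  have T_less: "(3 * s - 4 * s ^ 3)\<^sup>2 < x" if "0 \<le> s" "s < s0" for s
  proof -
    have "3 * s - 4 * s ^ 3 < sqrt x"
      unfolding T0[symmetric] using that s0 by (intro cubic_chebyshev_strict_mono) auto
    moreover have "0 \<le> 3 * s - 4 * s ^ 3" using that s0 by (intro T_nonneg) auto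
    ultimately have "(3 * s - 4 * s ^ 3)\<^sup>2 < (sqrt x)\<^sup>2" by (intro power_strict_mono) auto
    thus ?thesis using x by simp
  qed
  have Q_pos: "Q y > 0" if "y > p0" for y
  proof -
    have "y > -6" using that p0_6 by simp
    thus ?thesis using T_less[of "S y"] S_less[of p0 y] that p0_6 Sp0 S[of y] x
      by (auto simp: Q_eq intro!: mult_pos_pos divide_pos_pos)
  qed
  have Q_neg: "Q y < 0" if "8 * x - 6 < y" "y < p0" for y
  proof -
    have y: "y > -6" using that half6 by simp
    have Sy: "s0 < S y" "S y < 1/2" using S_less[of y p0] S_less[of "8*x-6" y] that half6 y Sp0 Shalf by auto
    have "sqrt x < 3 * S y - 4 * S y ^ 3"
      unfolding T0[symmetric] using Sy s0 by (intro cubic_chebyshev_strict_mono) auto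
    hence "(sqrt x)\<^sup>2 < (3 * S y - 4 * S y ^ 3)\<^sup>2" using sx by (intro power_strict_mono) auto
    hence "x - (3 * S y - 4 * S y ^ 3)\<^sup>2 < 0" using x by simp
    thus ?thesis unfolding Q_eq[OF y] using S[OF y] x by (intro mult_pos_neg divide_pos_pos) auto
  qed

  \<comment> \<open>\<open>p\<close> comes down from infinity and cannot cross \<open>p0\<close>, because \<open>Q\<close> is negative just below it.\<close>
  have p_ge: "p u \<ge> p0" if u: "0 < u" "u \<le> t" for u
  proof (rule ccontr)
    assume "\<not> ?thesis"
    hence less: "p u < p0" by simp
    \<comment> \<open>The intermediate value must be below \<open>p0\<close>, yet above
      \<open>8 * x - 6\<close> for the sign of \<open>Q\<close> to be known, even if
      \<open>p u\<close> itself lies lower. The maximum with the midpoint achieves both.\<close>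
    define q where "q = max (p u) ((p0 + (8 * x - 6)) / 2)"
    have q: "p u \<le> q" "8 * x - 6 < q" "q < p0" using less p0_half by (auto simp: q_def less_max_iff_disj)
    have "eventually (\<lambda>v. p v \<ge> q) (at_right 0)" using lim by (simp add: filterlim_at_top)
    moreover have "eventually (\<lambda>v. 0 < v \<and> v < u) (at_right 0)"
      using u by (auto simp: eventually_at_right_field)
    ultimately have "eventually (\<lambda>v. q \<le> p v \<and> 0 < v \<and> v < u) (at_right 0)"
      by eventually_elim auto
    then obtain v where v: "q \<le> p v" "0 < v" "v < u"
      using eventually_happens'[OF trivial_limit_at_right_real] by blast
    have "\<exists>w\<ge>v. w \<le> u \<and> p w = q"
    proof (rule IVT2)
      show "\<forall>w. v \<le> w \<and> w \<le> u \<longrightarrow> isCont p w"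
        using v u by (auto intro!: DERIV_isCont[OF dp])
    qed (use v q in auto)
    then obtain w where w: "0 < w" "w \<le> t" "p w = q" using v u by (metis order_less_le_trans order_trans)
    have "Q q < 0" using q by (intro Q_neg) auto
    moreover have "Q q \<ge> 0" using ode[OF w(1,2)] w(3) by (metis zero_le_power2)
    ultimately show False by simp
  qed
  \<comment> \<open>The second bound says that \<open>6 p^2 - 24 (9 - 8 x)\<close> is positive for
    \<open>p\<close> at least \<open>p0\<close>. Hence \<open>p1\<close> increases strictly up to
    its zero at \<open>t\<close> and is negative before. With \<open>r = s0^2\<close> everything is
    a polynomial in \<open>r\<close>, because \<open>x = r (3 - 4 r)^2\<close>.\<close>
  have p0_bounds: "p0 > 0" "p0\<^sup>2 > 4 * (9 - 8 * x)"
  proof -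
    define r where "r = s0\<^sup>2"
    have r: "0 < r" "r < 1/4"
      using s0 power_strict_mono[of s0 "1/2" 2] by (auto simp: r_def power2_eq_square)
    have "sqrt x = s0 * (3 - 4 * r)" unfolding T0[symmetric] r_def
      by (simp add: algebra_simps power2_eq_square power3_eq_cube)
    hence "(sqrt x)\<^sup>2 = r * (3 - 4 * r)\<^sup>2" by (simp add: power_mult_distrib r_def)
    hence xr: "x = r * (3 - 4 * r)\<^sup>2" using x by simp
    have p0r: "p0 = 2 * (3 - 4 * r)\<^sup>2 - 6" using r by (simp add: p0_def r_def[symmetric] xr)
    have "(2::real)\<^sup>2 < (3 - 4 * r)\<^sup>2" using r by (intro power_strict_mono) auto
    thus "p0 > 0" by (simp add: p0r)
    have "p0\<^sup>2 - 4 * (9 - 8 * x) = 4 * (1 - 4 * r) * (3 - 4 * r) ^ 3"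
      unfolding p0r xr by (simp add: algebra_simps power2_eq_square power3_eq_cube)
    also have "\<dots> > 0" using r by (intro mult_pos_pos zero_less_power) auto
    finally show "p0\<^sup>2 > 4 * (9 - 8 * x)" by simp
  qed
  have p1_neg: "p1 u < 0" if u: "0 < u" "u < t" for u
  proof -
    have "p1 u < p1 t"
    proof (rule DERIV_pos_imp_increasing[OF u(2)])
      fix v assume v: "u \<le> v" "v \<le> t"
      have "p0\<^sup>2 \<le> (p v)\<^sup>2" using p_ge[of v] u v p0_bounds by (intro power_mono) auto
      thus "\<exists>y. (p1 has_real_derivative y) (at v) \<and> 0 < y"
        using u v dp1[of v] p0_bounds by (intro exI[of _ "6 * (p v)\<^sup>2 - 24 * (9 - 8 * x)"]) auto
    qed
    thus ?thesis by (simp add: p1t)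
  qed
  \<comment> \<open>A zero of \<open>p1\<close> is a root of \<open>Q\<close> at \<open>p t\<close>,
    and \<open>Q\<close> has no root above \<open>p0\<close>.\<close>
  have pt: "p t = p0"
    using ode[of t] p1t Q_pos[of "p t"] p_ge[of t] t by force
  have p_gr: "p u > p0" if u: "0 < u" "u < t" for u
    unfolding pt[symmetric]
  proof (rule DERIV_neg_imp_decreasing_open[OF u(2)])
    show "\<exists>y. (p has_real_derivative y) (at v) \<and> y < 0" if "u < v" "v < t" for v
      using that u dp[of v] p1_neg[of v] by auto
    show "continuous_on {u..t} p"
      using u by (intro continuous_at_imp_continuous_on ballI DERIV_isCont[OF dp]) auto
  qed

  define s where "s u = S (p u)" for u
  have s_pos: "0 < s u" if "0 < u" "u \<le> t" for u
    unfolding s_def using p_ge[OF that] p0_6 by (intro S) auto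
  have s_less: "s u < s0" if "0 < u" "u < t" for u
    unfolding s_def Sp0[symmetric] using p_gr[OF that] p0_6 by (intro S_less) auto
  have st: "s t = s0" by (simp add: s_def pt Sp0)
  define y where "y u = (3 * s u - 4 * s u ^ 3) / sqrt x" for u
  define \<theta> where "\<theta> u = arcsin (y u)" for u
  have yt: "y t = 1" using sx by (simp add: y_def st T0)
  have y_bounds: "0 \<le> y u" "y u < 1" if u: "0 < u" "u < t" for u
  proof -
    show "0 \<le> y u" unfolding y_def
      using s_pos[of u] s_less[OF u] u s0 sx by (intro divide_nonneg_pos T_nonneg) auto
    have "3 * s u - 4 * s u ^ 3 < sqrt x"
      unfolding T0[symmetric] using s_pos[of u] s_less[of u] u s0
      by (intro cubic_chebyshev_strict_mono) auto
    thus "y u < 1" using sx by (simp add: y_def)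
  qed
  have s_cont: "isCont s u" if u: "0 < u" "u \<le> t" for u
  proof -
    have "p u + 6 \<noteq> 0" using p_ge[OF u] p0_6 by simp
    thus ?thesis unfolding s_def S_def using DERIV_isCont[OF dp[OF u]]
      by (intro continuous_intros) auto
  qed
  have ds: "(s has_real_derivative sqrt 2 * sqrt (x - (3 * s u - 4 * s u ^ 3)\<^sup>2)) (at u)"
    if u: "0 < u" "u < t" for u
  proof -
    have p6: "p u > -6" using p_gr[OF u] p0_6 by simp
    have su: "0 < s u" using s_pos u by simp
    have pu: "p u + 6 = 2 * x / (s u)\<^sup>2" using S(2)[OF p6] unfolding s_def by linarith
    define R where "R = sqrt (x - (3 * s u - 4 * s u ^ 3)\<^sup>2)"
    have R: "R\<^sup>2 = x - (3 * s u - 4 * s u ^ 3)\<^sup>2" "R \<ge> 0"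
      unfolding R_def using T_less[of "s u"] s_less[OF u] su by auto
    \<comment> \<open>The differential equation gives \<open>p1\<close> only up to sign;
      \<open>p1 < 0\<close> selects the root.\<close>
    have "(- p1 u)\<^sup>2 = Q (p u)" using ode[of u] u by simp
    also have "\<dots> = 32 * x\<^sup>2 / s u ^ 6 * R\<^sup>2" using Q_eq[OF p6] unfolding s_def[symmetric] R by simp
    also have "\<dots> = (4 * sqrt 2 * x / s u ^ 3 * R)\<^sup>2"
      by (simp add: power_mult_distrib power_divide power_mult[symmetric])
    finally have "- p1 u = 4 * sqrt 2 * x / s u ^ 3 * R"
      by (rule power2_eq_imp_eq) (use p1_neg[OF u] x su R in auto)
    hence p1u: "p1 u = - (4 * sqrt 2 * x / s u ^ 3 * R)" by simp
    have "((\<lambda>u. 2 * x / (p u + 6)) has_real_derivative - (2 * x * p1 u / (p u + 6)\<^sup>2)) (at u)"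
      using p6 u by (auto intro!: derivative_eq_intros dp simp: power2_eq_square)
    hence "(s has_real_derivative - (2 * x * p1 u / (p u + 6)\<^sup>2) * (inverse (sqrt (2 * x / (p u + 6))) / 2)) (at u)"
      unfolding s_def S_def using p6 x
      by (intro DERIV_cong[OF DERIV_chain2[OF DERIV_real_sqrt]]) (auto simp: mult_ac)
    also have "sqrt (2 * x / (p u + 6)) = s u" by (simp add: s_def S_def)
    also have "- (2 * x * p1 u / (p u + 6)\<^sup>2) * (inverse (s u) / 2) = sqrt 2 * R"
      unfolding p1u pu using su x by (simp add: field_simps power2_eq_square power3_eq_cube)
    finally show ?thesis unfolding R_def .
  qed
  \<comment> \<open>By \<open>cubic_series_chebyshev\<close> the factor \<open>1 - 4 (s u)^2\<close>
    is the reciprocal of the hypergeometric integrand at \<open>\<theta> u\<close>. The point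
    \<open>t\<close> is left out because \<open>y t = 1\<close>, where arcsin is not
    differentiable.\<close>
  have d\<theta>: "(\<theta> has_real_derivative 3 * sqrt 2 * (1 - 4 * (s u)\<^sup>2)) (at u)" if u: "0 < u" "u < t" for u
  proof -
    define T where "T = 3 * s u - 4 * s u ^ 3"
    define R where "R = sqrt (x - T\<^sup>2)"
    have R: "R > 0" unfolding R_def T_def using T_less[of "s u"] s_less[OF u] s_pos[of u] u by auto
    have "(y has_real_derivative (3 - 12 * (s u)\<^sup>2) * (sqrt 2 * R) / sqrt x) (at u)"
      unfolding y_def R_def T_def
    proof (rule DERIV_cdivide, goal_cases)
      case 1
      show ?case
        by (auto intro!: derivative_eq_intros ds u simp: algebra_simps power2_eq_square)
    qed
    hence "(\<theta> has_real_derivative (3 - 12 * (s u)\<^sup>2) * (sqrt 2 * R) / sqrt x * inverse (sqrt (1 - (y u)\<^sup>2))) (at u)"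
      unfolding \<theta>_def using y_bounds[OF u]
      by (intro DERIV_cong[OF DERIV_chain2[OF DERIV_arcsin]]) (auto simp: mult_ac)
    also have "sqrt (1 - (y u)\<^sup>2) = R / sqrt x"
      unfolding R_def real_sqrt_divide[symmetric] y_def T_def[symmetric]
      using x by (simp add: power_divide diff_divide_distrib)
    also have "(3 - 12 * (s u)\<^sup>2) * (sqrt 2 * R) / sqrt x * inverse (R / sqrt x) = 3 * sqrt 2 * (1 - 4 * (s u)\<^sup>2)"
      using R sx by (simp add: field_simps)
    finally show ?thesis .
  qed
  have \<theta>_cont: "continuous_on {0<..t} \<theta>"
    unfolding \<theta>_def
  proof (rule continuous_on_arcsin)
    show "continuous_on {0<..t} y"
      unfolding y_def using s_cont sx
      by (intro continuous_intros continuous_at_imp_continuous_on) auto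
    show "\<forall>u\<in>{0<..t}. -1 \<le> y u \<and> y u \<le> 1"
      using y_bounds yt by (smt (verit) greaterThanAtMost_iff)
  qed
  have s_lim: "(s \<longlongrightarrow> 0) (at_right 0)"
  proof -
    have "filterlim (\<lambda>u. p u + 6) at_top (at_right 0)"
      using filterlim_tendsto_add_at_top[OF tendsto_const[of 6] lim] by (simp add: add.commute)
    hence "((\<lambda>u. sqrt (2 * x / (p u + 6))) \<longlongrightarrow> sqrt 0) (at_right 0)"
      by (intro tendsto_real_sqrt real_tendsto_divide_at_top[OF tendsto_const])
    thus ?thesis by (simp add: s_def[abs_def] S_def)
  qed
  have \<theta>_lim: "(\<theta> \<longlongrightarrow> 0) (at_right 0)"
  proof -
    have "((\<lambda>u. (3 * s u - 4 * s u ^ 3) / sqrt x) \<longlongrightarrow> (3 * 0 - 4 * 0 ^ 3) / sqrt x) (at_right 0)"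
      using sx by (intro tendsto_intros s_lim) auto
    hence "((\<lambda>u. arcsin (y u)) \<longlongrightarrow> arcsin 0) (at_right 0)"
      unfolding y_def by (intro isCont_tendsto_compose[OF isCont_arcsin]) auto
    thus ?thesis by (simp add: \<theta>_def[abs_def])
  qed

  define g where "g \<phi> = cubic_series (x * (sin \<phi>)\<^sup>2)" for \<phi>
  have g_cont: "continuous_on {0..pi/2} g"
  proof -
    obtain f1 where "\<And>y. \<bar>y\<bar> < 1 \<Longrightarrow> (cubic_series has_real_derivative f1 y) (at y)"
      using cubic_series_ode by metis
    hence "isCont cubic_series z" if "\<bar>z\<bar> < 1" for z using that DERIV_isCont by metis
    moreover have "\<bar>x * (sin \<phi>)\<^sup>2\<bar> < 1" for \<phi>
    proof -
      have "x * (sin \<phi>)\<^sup>2 \<le> x * 1" using x by (intro mult_left_mono) (auto simp: abs_square_le_1)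
      also have "\<dots> < 1" using x by simp
      finally show ?thesis using x by (simp add: abs_mult)
    qed
    ultimately have "isCont (\<lambda>\<phi>. cubic_series (x * (sin \<phi>)\<^sup>2)) \<phi>" for \<phi>
      by (intro isCont_o2[where f = "\<lambda>\<phi>. x * (sin \<phi>)\<^sup>2" and g = cubic_series] continuous_intros) blast
    thus ?thesis unfolding g_def by (intro continuous_at_imp_continuous_on) auto
  qed
  define U where "U \<phi> = integral {0..\<phi>} g" for \<phi>
  have dU: "(U has_real_derivative g \<phi>) (at \<phi> within {0..pi/2})" if "\<phi> \<in> {0..pi/2}" for \<phi>
    unfolding U_def by (rule integral_has_real_derivative[OF g_cont that])
  have U_cont: "continuous_on {0..pi/2} U"
    using dU by (meson DERIV_continuous_on)
  have Upi: "U (pi/2) = pi / 2 * hyp2F1 (1/3) (2/3) 1 x"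
    unfolding U_def g_def using has_integral_hyp2F1[of x] x by (intro integral_unique) auto
  have U0: "U 0 = 0" by (simp add: U_def)
  have \<theta>_in: "0 \<le> \<theta> u" "\<theta> u < pi/2" if u: "0 < u" "u < t" for u
    unfolding \<theta>_def
    using y_bounds[OF u] arcsin_le_arcsin[of 0 "y u"] arcsin_less_arcsin[of "y u" 1] by auto
  \<comment> \<open>Instead of inverting \<theta>, compare the integral up to
    \<open>\<theta> u\<close> with \<open>3 * sqrt 2 * u\<close>. The difference is constant in the
    interior and tends to 0 at the pole; its value at \<open>t\<close>, reached by continuity, is
    the claim.\<close>
  define \<Phi> where "\<Phi> u = U (\<theta> u) - 3 * sqrt 2 * u" for u
  have y_pos: "0 < y u" if u: "0 < u" "u < t" for u
    unfolding y_def using cubic_chebyshev_strict_mono[of 0 "s u"] s_pos[of u] s_less[OF u] s0 u sx by auto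
  \<comment> \<open>Strict positivity puts \<open>\<theta> u\<close> in the interior of
    \<open>{0..pi/2}\<close>, where the derivative of \<open>U\<close> within the interval is a full
    derivative.\<close>
  have \<theta>_pos: "0 < \<theta> u" if u: "0 < u" "u < t" for u
    unfolding \<theta>_def using y_bounds[OF u] y_pos[OF u] arcsin_less_arcsin[of 0 "y u"] by auto
  have d\<Phi>: "(\<Phi> has_real_derivative 0) (at u)" if u: "0 < u" "u < t" for u
  proof -
    have "(U has_real_derivative g (\<theta> u)) (at (\<theta> u))"
      using dU[of "\<theta> u"] \<theta>_pos[OF u] \<theta>_in[OF u] at_within_interior[of "\<theta> u" "{0..pi/2}"] by auto
    hence "(\<Phi> has_real_derivative g (\<theta> u) * (3 * sqrt 2 * (1 - 4 * (s u)\<^sup>2)) - 3 * sqrt 2 * 1) (at u)"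
      unfolding \<Phi>_def by (intro DERIV_diff DERIV_chain2[OF _ d\<theta>[OF u]] DERIV_cmult DERIV_ident)
    also have "g (\<theta> u) = cubic_series ((3 * s u - 4 * s u ^ 3)\<^sup>2)"
      using y_bounds[OF u] x by (simp add: g_def \<theta>_def y_def power_divide)
    also have "\<dots> = 1 / (1 - 4 * (s u)\<^sup>2)"
      using s_pos[of u] s_less[OF u] s0 u by (intro cubic_series_chebyshev) auto
    also have "1 / (1 - 4 * (s u)\<^sup>2) * (3 * sqrt 2 * (1 - 4 * (s u)\<^sup>2)) - 3 * sqrt 2 * 1 = 0"
    proof -
      have "(s u)\<^sup>2 < (1/2)\<^sup>2" using s_pos[of u] s_less[OF u] s0 u by (intro power_strict_mono) auto
      thus ?thesis by (simp add: power2_eq_square)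
    qed
    finally show ?thesis .
  qed
  have \<theta>t: "\<theta> t = pi/2" by (simp add: \<theta>_def yt)
  have \<Phi>_cont: "continuous_on {0<..t} \<Phi>"
  proof -
    have "\<theta> ` {0<..t} \<subseteq> {0..pi/2}"
    proof safe
      fix u assume "u \<in> {0<..t}"
      thus "\<theta> u \<in> {0..pi/2}" using \<theta>_in[of u] unfolding atLeastAtMost_iff
        by (cases "u = t") (simp_all add: \<theta>t less_imp_le)
    qed
    from continuous_on_compose2[OF U_cont \<theta>_cont this] show ?thesis
      unfolding \<Phi>_def by (intro continuous_intros)
  qed
  have const: "\<Phi> u = \<Phi> t" if u: "0 < u" "u < t" for u
  proof (rule DERIV_isconst_end[OF u(2), symmetric])
    show "continuous_on {u..t} \<Phi>" by (rule continuous_on_subset[OF \<Phi>_cont]) (use u in auto)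
    show "(\<Phi> has_real_derivative 0) (at v)" if "u < v" "v < t" for v
      using that u by (intro d\<Phi>) auto
  qed
  have ev: "eventually (\<lambda>u. 0 < u \<and> u < t) (at_right 0)"
    using t by (auto simp: eventually_at_right_field)
  have "((\<lambda>u. U (\<theta> u)) \<longlongrightarrow> U 0) (at_right 0)"
  proof (rule continuous_on_tendsto_compose[OF U_cont \<theta>_lim])
    show "\<forall>\<^sub>F u in at_right 0. \<theta> u \<in> {0..pi/2}"
      using ev by eventually_elim (use \<theta>_in in force)
  qed auto
  hence "(\<Phi> \<longlongrightarrow> U 0 - 3 * sqrt 2 * 0) (at_right 0)"
    unfolding \<Phi>_def by (intro tendsto_intros)
  moreover have "(\<Phi> \<longlongrightarrow> \<Phi> t) (at_right 0)"
    by (rule tendsto_eventually) (use ev in eventually_elim, use const in auto)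
  ultimately have "\<Phi> t = 0"
    using tendsto_unique[OF trivial_limit_at_right_real] U0 by fastforce
  hence "pi / 2 * hyp2F1 (1/3) (2/3) 1 x = 3 * sqrt 2 * t"
    by (simp add: \<Phi>_def \<theta>t Upi)
  thus ?thesis by (simp add: field_simps)
qed

section \<open>Values of the zeta function\<close>

lemma DERIV_unique_on_unit_interval:
  fixes f g :: "real \<Rightarrow> real"
  assumes "\<And>x. 0 < x \<Longrightarrow> x < 1 \<Longrightarrow> f x = g x" "0 < x" "x < 1"
    and f: "(f has_real_derivative D) (at x)" and g: "(g has_real_derivative E) (at x)"
  shows "D = E"
proof -
  have "(g has_real_derivative D) (at x)"
    by (rule has_field_derivative_transform_within_open[OF f, of "{0<..<1}"]) (use assms in auto)
  thus ?thesis using g by (rule DERIV_unique)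
qed

lemma DERIV_Polygamma_reflect:
  fixes x :: real
  assumes "x < 1"
  shows "((\<lambda>x. Polygamma n (1 - x)) has_real_derivative - Polygamma (Suc n) (1 - x)) (at x)"
proof -
  have "1 - x \<notin> \<int>\<^sub>\<le>\<^sub>0" using assms by (auto elim!: nonpos_Ints_cases)
  hence "((\<lambda>x. Polygamma n (1 - x)) has_real_derivative Polygamma (Suc n) (1 - x) * (- 1)) (at x)"
    by (intro DERIV_chain2[OF has_field_derivative_Polygamma]) (auto intro!: derivative_eq_intros)
  thus ?thesis by simp
qed

lemma DERIV_Polygamma_pos:
  fixes x :: real
  assumes "0 < x"
  shows "(Polygamma n has_real_derivative Polygamma (Suc n) x) (at x)"
  using assms by (intro has_field_derivative_Polygamma) (auto elim!: nonpos_Ints_cases)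

text \<open>Logarithmic derivative of the reflection formula for Gamma: differentiate the product
  form and cancel the common factor \<open>pi / sin (pi * x)\<close>.\<close>

lemma Digamma_reflection_real:
  fixes x :: real
  assumes x: "0 < x" "x < 1"
  shows "Digamma (1 - x) - Digamma x = pi * (cos (pi * x) / sin (pi * x))"
proof -
  have s: "sin (pi * y) > 0" if "0 < y" "y < 1" for y
    using that by (intro sin_gt_zero) auto
  have refl: "Gamma y * Gamma (1 - y) = pi / sin (pi * y)" for y :: real
  proof -
    have "complex_of_real (Gamma y * Gamma (1 - y)) = complex_of_real (pi / sin (pi * y))"
      using Gamma_reflection_complex[of "complex_of_real y"]
      by (simp add: Gamma_complex_of_real[symmetric] sin_of_real[symmetric])
    thus ?thesis by (simp only: of_real_eq_iff)
  qed
  have np: "x \<notin> \<int>\<^sub>\<le>\<^sub>0" "1 - x \<notin> \<int>\<^sub>\<le>\<^sub>0" using x by (auto elim!: nonpos_Ints_cases)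
  have "((\<lambda>x. Gamma (1 - x)) has_real_derivative (Gamma (1 - x) * Digamma (1 - x)) * (- 1)) (at x)"
    using np by (intro DERIV_chain2[OF has_field_derivative_Gamma]) (auto intro!: derivative_eq_intros)
  hence "((\<lambda>x. Gamma x * Gamma (1 - x)) has_real_derivative
      Gamma x * Digamma x * Gamma (1 - x) + ((Gamma (1 - x) * Digamma (1 - x)) * (- 1)) * Gamma x) (at x)"
    using np by (intro DERIV_mult has_field_derivative_Gamma) auto
  moreover have "((\<lambda>x. pi / sin (pi * x)) has_real_derivative - (pi * pi * cos (pi * x) / (sin (pi * x) * sin (pi * x)))) (at x)"
    using s[OF x] by (auto intro!: derivative_eq_intros simp: field_simps)
  ultimately have "Gamma x * Digamma x * Gamma (1 - x) + ((Gamma (1 - x) * Digamma (1 - x)) * (- 1)) * Gamma x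
     = - (pi * pi * cos (pi * x) / (sin (pi * x) * sin (pi * x)))"
    by (rule DERIV_unique_on_unit_interval[OF refl x])
  hence "(Gamma x * Gamma (1 - x)) * (Digamma (1 - x) - Digamma x) = pi * pi * cos (pi * x) / (sin (pi * x) * sin (pi * x))"
    by (simp add: algebra_simps)
  hence "pi / sin (pi * x) * (Digamma (1 - x) - Digamma x) = pi / sin (pi * x) * (pi * (cos (pi * x) / sin (pi * x)))"
    unfolding refl by simp
  thus ?thesis using s[OF x] by (simp only: mult_cancel_left) simp
qed

text \<open>The inner derivative of \<open>1 - x\<close> is -1, so the sign in front of the
  reflected term alternates with every differentiation.\<close>

lemma Polygamma_reflection_step:
  fixes f :: "real \<Rightarrow> real"
  assumes "\<And>x. 0 < x \<Longrightarrow> x < 1 \<Longrightarrow> Polygamma n x + c * Polygamma n (1 - x) = f x"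
    and "\<And>x. 0 < x \<Longrightarrow> x < 1 \<Longrightarrow> (f has_real_derivative g x) (at x)"
    and x: "0 < x" "x < 1"
  shows "Polygamma (Suc n) x - c * Polygamma (Suc n) (1 - x) = g x"
proof -
  have "((\<lambda>x. Polygamma n x + c * Polygamma n (1 - x)) has_real_derivative
      Polygamma (Suc n) x + c * (- Polygamma (Suc n) (1 - x))) (at x)"
    using x by (intro DERIV_add DERIV_cmult DERIV_Polygamma_pos DERIV_Polygamma_reflect)
  from DERIV_unique_on_unit_interval[OF assms(1) x this assms(2)[OF x]] show ?thesis by simp
qed

text \<open>The reflection \<open>x \<mapsto> 1 - x\<close> fixes 1/2. In odd orders the reflected
  term carries a plus sign, so the two equal terms add up there, while in even orders they
  cancel.\<close>

lemma Polygamma_half: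
  "Polygamma 3 (1/2 :: real) = pi ^ 4" "Polygamma 5 (1/2 :: real) = 8 * pi ^ 6"
proof -
  let ?s = "\<lambda>x. sin (pi * x)" and ?c = "\<lambda>x. cos (pi * x)"
  have s: "?s y > 0" if "0 < y" "y < 1" for y
    using that by (intro sin_gt_zero) auto
  have c2: "(?c y)\<^sup>2 = 1 - (?s y)\<^sup>2" for y by (simp add: cos_squared_eq)
  have 0: "Polygamma 0 x + (-1) * Polygamma 0 (1 - x) = - pi * (?c x / ?s x)" if "0 < x" "x < 1" for x
    using Digamma_reflection_real[OF that] by simp
  have d0: "((\<lambda>x. - pi * (?c x / ?s x)) has_real_derivative pi\<^sup>2 * (1 / (?s x)\<^sup>2)) (at x)" if "0 < x" "x < 1" for x
  proof -
    have "((\<lambda>x. - pi * (?c x / ?s x)) has_real_derivative pi\<^sup>2 + pi\<^sup>2 * ((?c x)\<^sup>2 / (?s x)\<^sup>2)) (at x)"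
      using s[OF that] by (auto intro!: derivative_eq_intros simp: field_simps power2_eq_square)
    also have "pi\<^sup>2 + pi\<^sup>2 * ((?c x)\<^sup>2 / (?s x)\<^sup>2) = pi\<^sup>2 * (1 / (?s x)\<^sup>2)"
      unfolding c2 using s[OF that] by (simp add: field_simps)
    finally show ?thesis .
  qed
  have 1: "Polygamma 1 x + 1 * Polygamma 1 (1 - x) = pi\<^sup>2 * (1 / (?s x)\<^sup>2)" if "0 < x" "x < 1" for x
    using Polygamma_reflection_step[OF 0 d0 that] by simp
  have d1: "((\<lambda>x. pi\<^sup>2 * (1 / (?s x)\<^sup>2)) has_real_derivative - 2 * pi ^ 3 * (?c x / ?s x ^ 3)) (at x)"
    if "0 < x" "x < 1" for x
    using s[OF that] by (auto intro!: derivative_eq_intros simp: field_simps power2_eq_square power3_eq_cube)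
  have 2: "Polygamma 2 x + (-1) * Polygamma 2 (1 - x) = - 2 * pi ^ 3 * (?c x / ?s x ^ 3)" if "0 < x" "x < 1" for x
    using Polygamma_reflection_step[OF 1 d1 that] by (simp add: eval_nat_numeral)
  have d2: "((\<lambda>x. - 2 * pi ^ 3 * (?c x / ?s x ^ 3)) has_real_derivative pi ^ 4 * (6 / ?s x ^ 4 - 4 / ?s x ^ 2)) (at x)"
    if "0 < x" "x < 1" for x
  proof -
    have "((\<lambda>x. - 2 * pi ^ 3 * (?c x / ?s x ^ 3)) has_real_derivative
        2 * pi ^ 4 * (((?s x)\<^sup>2 + 3 * (?c x)\<^sup>2) / ?s x ^ 4)) (at x)"
      using s[OF that] by (auto intro!: derivative_eq_intros simp: field_simps power_numeral_reduce)
    also have "2 * pi ^ 4 * (((?s x)\<^sup>2 + 3 * (?c x)\<^sup>2) / ?s x ^ 4) = pi ^ 4 * (6 / ?s x ^ 4 - 4 / ?s x ^ 2)"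
      unfolding c2 using s[OF that] by (simp add: field_simps power_numeral_reduce)
    finally show ?thesis .
  qed
  have 3: "Polygamma 3 x + 1 * Polygamma 3 (1 - x) = pi ^ 4 * (6 / ?s x ^ 4 - 4 / ?s x ^ 2)" if "0 < x" "x < 1" for x
    using Polygamma_reflection_step[OF 2 d2 that] by (simp add: eval_nat_numeral)
  have d3: "((\<lambda>x. pi ^ 4 * (6 / ?s x ^ 4 - 4 / ?s x ^ 2)) has_real_derivative
      pi ^ 5 * (?c x * (8 / ?s x ^ 3 - 24 / ?s x ^ 5))) (at x)" if "0 < x" "x < 1" for x
    using s[OF that] by (auto intro!: derivative_eq_intros simp: field_simps power_numeral_reduce)
  have 4: "Polygamma 4 x + (-1) * Polygamma 4 (1 - x) = pi ^ 5 * (?c x * (8 / ?s x ^ 3 - 24 / ?s x ^ 5))" if "0 < x" "x < 1" for x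
    using Polygamma_reflection_step[OF 3 d3 that] by (simp add: eval_nat_numeral)
  have d4: "((\<lambda>x. pi ^ 5 * (?c x * (8 / ?s x ^ 3 - 24 / ?s x ^ 5))) has_real_derivative
      pi ^ 6 * (- ?s x * (8 / ?s x ^ 3 - 24 / ?s x ^ 5) + (?c x)\<^sup>2 * (120 / ?s x ^ 6 - 24 / ?s x ^ 4))) (at x)" if "0 < x" "x < 1" for x
    using s[OF that] by (auto intro!: derivative_eq_intros simp: field_simps power_numeral_reduce)
  have 5: "Polygamma 5 x + 1 * Polygamma 5 (1 - x) =
      pi ^ 6 * (- ?s x * (8 / ?s x ^ 3 - 24 / ?s x ^ 5) + (?c x)\<^sup>2 * (120 / ?s x ^ 6 - 24 / ?s x ^ 4))" if "0 < x" "x < 1" for x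
    using Polygamma_reflection_step[OF 4 d4 that] by (simp add: eval_nat_numeral)
  show "Polygamma 3 (1/2 :: real) = pi ^ 4" using 3[of "1/2"] by simp
  show "Polygamma 5 (1/2 :: real) = 8 * pi ^ 6" using 5[of "1/2"] by simp
qed

text \<open>Split the series by parity of the integers. The even ones reproduce it with factor
  \<open>(1/2) ^ Suc n\<close>, the odd ones give the series of \<open>Polygamma n (1/2)\<close>
  with the same factor; solving for the sum yields \<open>2 ^ Suc n - 1\<close>. For odd
  \<open>n\<close> the sign in \<open>Polygamma\<close> is positive.\<close>

lemma zeta_sums_from_half:
  assumes n: "0 < n" "odd n"
  shows "(\<lambda>k. 1 / real (Suc k) ^ Suc n) sums (Polygamma n (1/2) / (fact n * (2 ^ Suc n - 1)))"
proof -
  let ?f = "\<lambda>k. 1 / real (Suc k) ^ Suc n"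
  have sm: "summable ?f"
    using Polygamma_converges'[of "1::real" "Suc n"] n by (simp add: inverse_eq_divide del: power_Suc)
  define Z where "Z = suminf ?f"
  have Z: "?f sums Z" unfolding Z_def by (rule summable_sums[OF sm])
  have half: "(\<lambda>k. 1 / (1/2 + real k) ^ Suc n) sums (Polygamma n (1/2) / fact n)"
  proof -
    have "summable (\<lambda>k. inverse ((1/2 + real k) ^ Suc n))"
      by (rule Polygamma_converges') (use n in auto)
    from summable_sums[OF this] show ?thesis
      using n by (simp add: Polygamma_def inverse_eq_divide del: power_Suc)
  qed
  have "(\<lambda>k. sum ?f {k * 2..<k * 2 + 2}) sums Z" by (rule sums_group[OF Z]) simp
  also have "(\<lambda>k. sum ?f {k * 2..<k * 2 + 2}) =
      (\<lambda>k. (1/2) ^ Suc n * (1 / (1/2 + real k) ^ Suc n) + (1/2) ^ Suc n * ?f k)"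
  proof
    fix k :: nat
    have *: "(1/2) ^ Suc n * (1 / y ^ Suc n) = 1 / (2 * y) ^ Suc n" for y :: real
      by (simp add: power_mult_distrib power_divide del: power_Suc)
    \<comment> \<open>The term with index \<open>j\<close> belongs to the integer
      \<open>j + 1\<close>, so this block stands for the odd number \<open>2 k + 1\<close> and the
      even number \<open>2 k + 2\<close>.\<close>
    have "{k * 2..<k * 2 + 2} = {2 * k, 2 * k + 1}" by auto
    thus "sum ?f {k * 2..<k * 2 + 2} = (1/2) ^ Suc n * (1 / (1/2 + real k) ^ Suc n) + (1/2) ^ Suc n * ?f k"
      unfolding * by (simp add: algebra_simps del: power_Suc)
  qed
  finally have "(\<lambda>k. (1/2) ^ Suc n * (1 / (1/2 + real k) ^ Suc n) + (1/2) ^ Suc n * ?f k) sums Z" .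
  moreover have "(\<lambda>k. (1/2) ^ Suc n * (1 / (1/2 + real k) ^ Suc n) + (1/2) ^ Suc n * ?f k) sums
      ((1/2) ^ Suc n * (Polygamma n (1/2) / fact n) + (1/2) ^ Suc n * Z)"
    by (intro sums_add sums_mult half Z)
  ultimately have "Z = (1/2) ^ Suc n * (Polygamma n (1/2) / fact n) + (1/2) ^ Suc n * Z"
    by (rule sums_unique2)
  hence "2 ^ Suc n * Z = Polygamma n (1/2) / fact n + Z"
    by (simp add: power_divide field_simps del: power_Suc)
  hence "(2 ^ Suc n - 1) * Z = Polygamma n (1/2) / fact n" by (simp add: algebra_simps)
  moreover have "(2::real) ^ Suc n - 1 > 0" by (simp add: one_less_power del: power_Suc)
  ultimately have "Z = Polygamma n (1/2) / fact n / (2 ^ Suc n - 1)"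
    by (metis less_irrefl nonzero_mult_div_cancel_left)
  thus ?thesis using Z by (simp only: divide_divide_eq_left)
qed

lemma zeta_4_sums: "(\<lambda>k. 1 / real (Suc k) ^ 4) sums (pi ^ 4 / 90)"
  using zeta_sums_from_half[of 3] by (simp add: Polygamma_half fact_numeral)

lemma zeta_6_sums: "(\<lambda>k. 1 / real (Suc k) ^ 6) sums (pi ^ 6 / 945)"
  using zeta_sums_from_half[of 5] by (simp add: Polygamma_half fact_numeral)

section \<open>The Weierstrass function of a rectangular lattice\<close>

lemma summable_on_int_powr: "(\<lambda>m::int. (1 + \<bar>real_of_int m\<bar>) powr (-3/2)) summable_on UNIV"
proof -
  let ?f = "\<lambda>m::int. (1 + \<bar>real_of_int m\<bar>) powr (-3/2)"
  have *: "(\<lambda>n::nat. (1 + real n) powr (-3/2)) summable_on UNIV"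
  proof (rule summable_nonneg_imp_summable_on)
    have "summable (\<lambda>n. real (Suc n) powr (-3/2))"
      unfolding summable_Suc_iff[of "\<lambda>n. real n powr (-3/2)"] by (subst summable_real_powr_iff) auto
    thus "summable (\<lambda>n. (1 + real n) powr (-3/2))" by (simp add: add.commute)
  qed auto
  have "?f summable_on range int"
    using * by (subst summable_on_reindex) (auto simp: o_def)
  moreover have "?f summable_on range (\<lambda>n. - int n)"
    using * by (subst summable_on_reindex) (auto simp: o_def inj_on_def)
  ultimately have "?f summable_on (range int \<union> range (\<lambda>n. - int n))"
    by (rule summable_on_union)
  also have "range int \<union> range (\<lambda>n. - int n) = UNIV"
    by (auto simp: image_iff) (metis int_cases2)
  finally show ?thesis .
qed

text \<open>Majorant, up to a constant, for the inverse cubes of the lattice points. It factors, so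
  the double sum reduces to one variable with exponent 3/2 > 1.\<close>

lemma summable_on_int_pair_powr:
  "(\<lambda>(m::int, n::int). ((1 + \<bar>real_of_int m\<bar>) * (1 + \<bar>real_of_int n\<bar>)) powr (-3/2)) summable_on UNIV"
proof -
  let ?f = "\<lambda>m::int. (1 + \<bar>real_of_int m\<bar>) powr (-3/2)"
  have "(\<lambda>(m, n). ?f m * ?f n) summable_on (UNIV \<times> UNIV)"
  proof (rule summable_on_SigmaI)
    show "((\<lambda>n. case (m, n) of (m, n) \<Rightarrow> ?f m * ?f n) has_sum ?f m * infsum ?f UNIV) UNIV" for m
      using has_sum_cmult_right[OF has_sum_infsum[OF summable_on_int_powr]] by simp
    show "(\<lambda>m. ?f m * infsum ?f UNIV) summable_on UNIV"
      by (intro summable_on_cmult_left summable_on_int_powr)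
  qed auto
  thus ?thesis by (simp add: powr_mult)
qed

lemma DERIV_one_over_power:
  fixes z c :: complex
  assumes "z \<noteq> c" "0 < k"
  shows "((\<lambda>z. 1 / (z - c) ^ k) has_field_derivative - of_nat k * (1 / (z - c) ^ Suc k)) (at z)"
proof -
  obtain n where k: "k = Suc n" using assms(2) by (cases k) auto
  have "((\<lambda>z. (z - c) ^ k) has_field_derivative of_nat k * (z - c) ^ n) (at z)"
    by (rule derivative_eq_intros refl)+ (simp add: k)
  from DERIV_inverse_fun[OF this] assms(1)
  have "((\<lambda>z. 1 / (z - c) ^ k) has_field_derivative
      - (inverse ((z - c) ^ k) * (of_nat k * (z - c) ^ n) * inverse ((z - c) ^ k))) (at z)"
    by (simp add: inverse_eq_divide)
  also have "- (inverse ((z - c) ^ k) * (of_nat k * (z - c) ^ n) * inverse ((z - c) ^ k))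
      = - of_nat k * (1 / (z - c) ^ Suc k)"
    using assms(1) by (simp add: k divide_simps)
  finally show ?thesis .
qed

locale rect_lattice =
  fixes a b :: real
  assumes a_pos: "0 < a" and b_pos: "0 < b"
begin

definition w :: "int \<times> int \<Rightarrow> complex" where
  "w = (\<lambda>(m, n). 2 * of_int m * of_real a + 2 * of_int n * (\<i> * of_real b))"

lemma Re_w: "Re (w q) = 2 * of_int (fst q) * a" and Im_w: "Im (w q) = 2 * of_int (snd q) * b"
  by (simp_all add: w_def case_prod_unfold)

lemma w_0 [simp]: "w 0 = 0" "w (0, 0) = 0"
  by (simp_all add: complex_eq_iff Re_w Im_w)

lemma w_minus: "w (- q) = - w q" and w_add: "w (q + r) = w q + w r" and w_diff: "w (q - r) = w q - w r"
  by (simp_all add: complex_eq_iff Re_w Im_w algebra_simps)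

lemma w_eq_iff: "w q = w r \<longleftrightarrow> q = r"
  using a_pos b_pos by (auto simp: complex_eq_iff Re_w Im_w prod_eq_iff)

lemma w_eq_0_iff [simp]: "w q = 0 \<longleftrightarrow> q = 0"
  using w_eq_iff[of q 0] by simp

lemma cnj_w: "cnj (w (m, n)) = w (m, - n)"
  by (simp add: complex_eq_iff Re_w Im_w)

definition r0 :: real where "r0 = min a b"

lemma r0_pos: "0 < r0" using a_pos b_pos by (simp add: r0_def)

text \<open>Both bounds go through \<open>M\<close>, the larger of the two absolute indices: the
  norm is at least \<open>2 * r0 * M\<close>, while \<open>M \<ge> 1\<close> bounds each factor
  \<open>1 + \<bar>m\<bar>\<close> and \<open>1 + \<bar>n\<bar>\<close> by
  \<open>2 * M\<close>.\<close>

lemma norm_w_lower: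
  assumes "q \<noteq> 0"
  shows "r0\<^sup>2 * ((1 + \<bar>real_of_int (fst q)\<bar>) * (1 + \<bar>real_of_int (snd q)\<bar>)) \<le> (norm (w q))\<^sup>2"
    and "2 * r0 \<le> norm (w q)"
proof -
  obtain m n where q: "q = (m, n)" by (cases q)
  define M where "M = max \<bar>real_of_int m\<bar> \<bar>real_of_int n\<bar>"
  have M1: "1 \<le> M" using assms by (auto simp: q M_def zero_prod_def le_max_iff_disj)
  have MM: "M\<^sup>2 \<le> (real_of_int m)\<^sup>2 + (real_of_int n)\<^sup>2"
    by (auto simp: M_def max_def)
  have "4 * r0\<^sup>2 * M\<^sup>2 \<le> 4 * r0\<^sup>2 * (real_of_int m)\<^sup>2 + 4 * r0\<^sup>2 * (real_of_int n)\<^sup>2"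
    using mult_left_mono[OF MM, of "4 * r0\<^sup>2"] by (simp add: algebra_simps)
  also have "\<dots> \<le> 4 * a\<^sup>2 * (real_of_int m)\<^sup>2 + 4 * b\<^sup>2 * (real_of_int n)\<^sup>2"
    using r0_pos a_pos b_pos by (intro add_mono mult_right_mono mult_left_mono power_mono) (auto simp: r0_def)
  also have "\<dots> = (norm (w q))\<^sup>2"
    by (simp add: cmod_power2 Re_w Im_w q power_mult_distrib)
  finally have 1: "(2 * r0 * M)\<^sup>2 \<le> (norm (w q))\<^sup>2" by (simp add: power_mult_distrib)
  hence 2: "2 * r0 * M \<le> norm (w q)" by (rule power2_le_imp_le) simp
  have "2 * r0 * 1 \<le> 2 * r0 * M" using M1 r0_pos by (intro mult_left_mono) auto
  thus "2 * r0 \<le> norm (w q)" using 2 by linarith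
  have "(1 + \<bar>real_of_int m\<bar>) * (1 + \<bar>real_of_int n\<bar>) \<le> (2 * M) * (2 * M)"
    using M1 by (intro mult_mono) (auto simp: M_def)
  hence "r0\<^sup>2 * ((1 + \<bar>real_of_int m\<bar>) * (1 + \<bar>real_of_int n\<bar>)) \<le> r0\<^sup>2 * ((2 * M) * (2 * M))"
    by (intro mult_left_mono) auto
  also have "\<dots> = (2 * r0 * M)\<^sup>2" by (simp add: power2_eq_square)
  finally show "r0\<^sup>2 * ((1 + \<bar>real_of_int (fst q)\<bar>) * (1 + \<bar>real_of_int (snd q)\<bar>)) \<le> (norm (w q))\<^sup>2"
    using 1 by (simp add: q)
qed

lemma norm_w_inverse_cube_le:
  "1 / norm (w q) ^ 3 \<le> 1 / r0 ^ 3 * ((1 + \<bar>real_of_int (fst q)\<bar>) * (1 + \<bar>real_of_int (snd q)\<bar>)) powr (-3/2)"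
proof (cases "q = 0")
  case True
  thus ?thesis using r0_pos by simp
next
  case False
  define P where "P = (1 + \<bar>real_of_int (fst q)\<bar>) * (1 + \<bar>real_of_int (snd q)\<bar>)"
  have P: "P > 0" unfolding P_def by (intro mult_pos_pos) auto
  have n: "norm (w q) > 0" using False by simp
  have "(r0 ^ 3 * P powr (3/2)) = (r0\<^sup>2 * P) powr (3/2)"
    using r0_pos P by (simp add: powr_mult powr_numeral[symmetric] powr_powr del: powr_numeral)
  also have "\<dots> \<le> ((norm (w q))\<^sup>2) powr (3/2)"
    using norm_w_lower(1)[OF False] r0_pos P unfolding P_def[symmetric] by (intro powr_mono2) auto
  also have "\<dots> = norm (w q) ^ 3"
    using n by (simp add: powr_numeral[symmetric] powr_powr del: powr_numeral)
  finally have "1 / norm (w q) ^ 3 \<le> 1 / (r0 ^ 3 * P powr (3/2))"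
    using r0_pos P by (intro divide_left_mono mult_pos_pos) (auto simp: n False)
  also have "\<dots> = 1 / r0 ^ 3 * P powr (-3/2)" by (simp add: powr_minus field_simps)
  finally show ?thesis by (simp add: P_def)
qed

text \<open>Exponent 3 has the product majorant. Larger exponents reduce to it because nonzero
  lattice points have norm at least \<open>2 * r0\<close>; at \<open>q = 0\<close> all terms are
  \<open>1 / 0 = 0\<close>.\<close>

lemma summable_norm_w:
  assumes "3 \<le> k"
  shows "(\<lambda>q. 1 / norm (w q) ^ k) summable_on A"
proof (rule summable_on_subset_banach)
  have 3: "(\<lambda>q. 1 / norm (w q) ^ 3) summable_on UNIV"
  proof (rule summable_on_comparison_test)
    show "(\<lambda>q. 1 / r0 ^ 3 * ((1 + \<bar>real_of_int (fst q)\<bar>) * (1 + \<bar>real_of_int (snd q)\<bar>)) powr (-3/2)) summable_on UNIV"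
      using summable_on_cmult_right[OF summable_on_int_pair_powr] unfolding case_prod_unfold .
  qed (use norm_w_inverse_cube_le in auto)
  show "(\<lambda>q. 1 / norm (w q) ^ k) summable_on UNIV"
  proof (rule summable_on_comparison_test)
    show "(\<lambda>q. 1 / (2 * r0) ^ (k - 3) * (1 / norm (w q) ^ 3)) summable_on UNIV"
      by (intro summable_on_cmult_right 3)
    show "1 / norm (w q) ^ k \<le> 1 / (2 * r0) ^ (k - 3) * (1 / norm (w q) ^ 3)" for q
    proof (cases "q = 0")
      case False
      have "(2 * r0) ^ (k - 3) * norm (w q) ^ 3 \<le> norm (w q) ^ (k - 3) * norm (w q) ^ 3"
        using norm_w_lower(2)[OF False] r0_pos by (intro mult_right_mono power_mono) auto
      also have "\<dots> = norm (w q) ^ k" using assms by (simp flip: power_add)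
      finally have "1 / norm (w q) ^ k \<le> 1 / ((2 * r0) ^ (k - 3) * norm (w q) ^ 3)"
        using r0_pos False by (intro divide_left_mono mult_pos_pos zero_less_power) auto
      thus ?thesis by simp
    qed (use assms in \<open>auto simp: power_0_left\<close>)
  qed auto
qed auto

lemma summable_w: "3 \<le> k \<Longrightarrow> (\<lambda>q. 1 / w q ^ k) summable_on A"
  by (rule abs_summable_summable) (use summable_norm_w in \<open>simp add: norm_divide norm_power\<close>)

section \<open>Termwise differentiation of sums over the lattice\<close>

lemma finite_norm_w_less: "finite {q. norm (w q) < R}"
proof (rule finite_subset)
  define N where "N = \<lceil>R / (2 * r0)\<rceil>"
  show "{q. norm (w q) < R} \<subseteq> {-N..N} \<times> {-N..N}"
  proof
    fix q assume "q \<in> {q. norm (w q) < R}"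
    hence *: "norm (w q) < R" by simp
    have "2 * r0 * \<bar>real_of_int (fst q)\<bar> \<le> 2 * a * \<bar>real_of_int (fst q)\<bar>"
      by (intro mult_right_mono) (auto simp: r0_def)
    also have "\<dots> = \<bar>Re (w q)\<bar>" using a_pos by (simp add: Re_w abs_mult)
    also have "\<dots> < R" using abs_Re_le_cmod[of "w q"] * by linarith
    finally have 1: "\<bar>real_of_int (fst q)\<bar> < R / (2 * r0)" using r0_pos by (simp add: field_simps)
    have "2 * r0 * \<bar>real_of_int (snd q)\<bar> \<le> 2 * b * \<bar>real_of_int (snd q)\<bar>"
      by (intro mult_right_mono) (auto simp: r0_def)
    also have "\<dots> = \<bar>Im (w q)\<bar>" using b_pos by (simp add: Im_w abs_mult)
    also have "\<dots> < R" using abs_Im_le_cmod[of "w q"] * by linarith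
    finally have 2: "\<bar>real_of_int (snd q)\<bar> < R / (2 * r0)" using r0_pos by (simp add: field_simps)
    show "q \<in> {-N..N} \<times> {-N..N}"
      using 1 2 unfolding N_def by (cases q) (auto, linarith+)
  qed
qed auto

text \<open>On the disc of radius \<open>R\<close> the finitely many lattice points of norm below
  \<open>2 * R\<close> are treated one by one, and the rest converges uniformly with no pole in the
  disc. Convergence of the differentiated series comes from the theorem on uniform limits, so no
  majorant of \<open>f'\<close> is asked for. The majorant may depend on \<open>R\<close>, as it
  does for \<wp>.\<close>

lemma lattice_sum_has_derivative:
  fixes f f' :: "int \<times> int \<Rightarrow> complex \<Rightarrow> complex" and M :: "real \<Rightarrow> int \<times> int \<Rightarrow> real"
  assumes le: "\<And>R q z. 0 < R \<Longrightarrow> 2 * R \<le> norm (w q) \<Longrightarrow> norm z \<le> R \<Longrightarrow> norm (f q z) \<le> M R q"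
    and M: "\<And>R A. 0 < R \<Longrightarrow> M R summable_on A"
    and deriv: "\<And>q z. z \<noteq> w q \<Longrightarrow> (f q has_field_derivative f' q z) (at z)"
    and z: "z \<notin> range w"
  shows "((\<lambda>z. \<Sum>\<^sub>\<infinity>q. f q z) has_field_derivative (\<Sum>\<^sub>\<infinity>q. f' q z)) (at z)"
proof -
  define R where "R = norm z + 1"
  have R: "R > 0" by (simp add: R_def add_nonneg_pos)
  define A where "A = {q. norm (w q) < 2 * R}"
  define B where "B = {q. 2 * R \<le> norm (w q)}"
  have AB: "A \<union> B = UNIV" "A \<inter> B = {}" by (auto simp: A_def B_def)
  have A: "finite A" unfolding A_def by (rule finite_norm_w_less)
  have Bw: "u \<noteq> w q" if "q \<in> B" "norm u \<le> R" for u q using that R by (auto simp: B_def)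
  have ulim: "uniform_limit (cball 0 R) (\<lambda>X u. \<Sum>q\<in>X. f q u) (\<lambda>u. \<Sum>\<^sub>\<infinity>q\<in>B. f q u) (finite_subsets_at_top B)"
    by (rule Weierstrass_m_test_general[where M = "M R"]) (use le R M in \<open>auto simp: B_def\<close>)
  have sB: "(\<lambda>q. f q u) summable_on B" if "norm u \<le> R" for u
    by (rule abs_summable_summable, rule Infinite_Sum.abs_summable_on_comparison_test'[OF M[OF R]])
       (use le R that in \<open>auto simp: B_def\<close>)
  obtain g' where g': "\<And>u. u \<in> ball 0 R \<Longrightarrow> ((\<lambda>u. \<Sum>\<^sub>\<infinity>q\<in>B. f q u) has_field_derivative (g' u)) (at u)
      \<and> ((\<lambda>X. \<Sum>q\<in>X. f' q u) \<longlongrightarrow> g' u) (finite_subsets_at_top B)"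
  proof (rule has_complex_derivative_uniform_limit[OF _ ulim _ R])
    show "\<forall>\<^sub>F X in finite_subsets_at_top B. continuous_on (cball 0 R) (\<lambda>u. \<Sum>q\<in>X. f q u) \<and>
        (\<forall>u\<in>ball 0 R. ((\<lambda>u. \<Sum>q\<in>X. f q u) has_field_derivative (\<Sum>q\<in>X. f' q u)) (at u))"
    proof (rule eventually_finite_subsets_at_top_weakI, intro conjI ballI)
      fix X assume X: "finite X" "X \<subseteq> B"
      have d: "((\<lambda>u. \<Sum>q\<in>X. f q u) has_field_derivative (\<Sum>q\<in>X. f' q u)) (at u)" if "norm u \<le> R" for u
        by (intro DERIV_sum deriv) (use that X Bw in blast)
      thus "continuous_on (cball 0 R) (\<lambda>u. \<Sum>q\<in>X. f q u)"
        by (intro continuous_at_imp_continuous_on ballI DERIV_isCont) auto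
      show "((\<lambda>u. \<Sum>q\<in>X. f q u) has_field_derivative (\<Sum>q\<in>X. f' q u)) (at u)" if "u \<in> ball 0 R" for u
        using d that by simp
    qed
  qed (use that in auto)
  have zR: "z \<in> ball 0 R" by (simp add: R_def)
  have sumB: "((\<lambda>q. f' q z) has_sum g' z) B"
    using g'[OF zR] by (simp add: has_sum_def)
  have sumU: "((\<lambda>q. f' q z) has_sum ((\<Sum>q\<in>A. f' q z) + g' z)) UNIV"
    unfolding AB(1)[symmetric] using A AB sumB by (intro has_sum_Un_disjoint) auto
  have "((\<lambda>u. (\<Sum>q\<in>A. f q u) + (\<Sum>\<^sub>\<infinity>q\<in>B. f q u)) has_field_derivative ((\<Sum>q\<in>A. f' q z) + g' z)) (at z)"
    using g'[OF zR] z by (intro DERIV_add DERIV_sum deriv) auto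
  also have "(\<Sum>q\<in>A. f' q z) + g' z = (\<Sum>\<^sub>\<infinity>q. f' q z)" using sumU by (simp add: infsumI)
  finally have *: "((\<lambda>u. (\<Sum>q\<in>A. f q u) + (\<Sum>\<^sub>\<infinity>q\<in>B. f q u)) has_field_derivative (\<Sum>\<^sub>\<infinity>q. f' q z)) (at z)" .
  show "((\<lambda>z. \<Sum>\<^sub>\<infinity>q. f q z) has_field_derivative (\<Sum>\<^sub>\<infinity>q. f' q z)) (at z)"
  proof (rule has_field_derivative_transform_within_open[OF * open_ball zR])
    fix u :: complex assume "u \<in> ball 0 R"
    hence u: "norm u \<le> R" by simp
    show "(\<Sum>q\<in>A. f q u) + (\<Sum>\<^sub>\<infinity>q\<in>B. f q u) = (\<Sum>\<^sub>\<infinity>q. f q u)"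
      using infsum_Un_disjoint[of "\<lambda>q. f q u" A B] A AB sB[OF u] by simp
  qed
qed

section \<open>The Weierstrass function and its derivatives\<close>

lemma half_norm_le: "norm (w q) / 2 \<le> norm (z - w q)" if "2 * norm z \<le> norm (w q)"
  using norm_triangle_ineq2[of "w q" z] that by (simp add: norm_minus_commute)

text \<open>Away from the lattice, \<open>- 2 * eis 3\<close> and \<open>6 * eis 4\<close> are the
  first and second derivatives of \<wp>.\<close>

definition eis :: "nat \<Rightarrow> complex \<Rightarrow> complex" where
  "eis k z = (\<Sum>\<^sub>\<infinity>q. 1 / (z - w q) ^ k)"

text \<open>For \<open>q = 0\<close> the convention \<open>1 / 0 = 0\<close> makes the summand equal to \<open>1 / z\<^sup>2\<close>, so
  no index has to be excluded.\<close>

definition wp :: "complex \<Rightarrow> complex" where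
  "wp z = (\<Sum>\<^sub>\<infinity>q. 1 / (z - w q) ^ 2 - 1 / w q ^ 2)"

lemma has_field_derivative_eis:
  assumes k: "3 \<le> k" and z: "z \<notin> range w"
  shows "(eis k has_field_derivative - of_nat k * eis (Suc k) z) (at z)"
proof -
  have le: "norm (1 / (z - w q) ^ k) \<le> 2 ^ k * (1 / norm (w q) ^ k)"
    if "0 < R" "2 * R \<le> norm (w q)" "norm z \<le> R" for q z R
  proof -
    have "(norm (w q) / 2) ^ k \<le> norm (z - w q) ^ k"
      using that by (intro power_mono half_norm_le) auto
    hence "1 / norm (z - w q) ^ k \<le> 1 / (norm (w q) / 2) ^ k"
      using that half_norm_le[of z q] by (intro divide_left_mono mult_pos_pos zero_less_power) auto
    thus ?thesis by (simp add: norm_divide norm_power power_divide)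
  qed
  have sm: "(\<lambda>q. 2 ^ k * (1 / norm (w q) ^ k)) summable_on A" for A
    by (intro summable_on_cmult_right summable_norm_w k)
  have d: "((\<lambda>z. 1 / (z - w q) ^ k) has_field_derivative - of_nat k * (1 / (z - w q) ^ Suc k)) (at z)"
    if "z \<noteq> w q" for q z
    using k that by (intro DERIV_one_over_power) auto
  note L = lattice_sum_has_derivative[where f = "\<lambda>q z. 1 / (z - w q) ^ k"
      and f' = "\<lambda>q z. - of_nat k * (1 / (z - w q) ^ Suc k)" and M = "\<lambda>R q. 2 ^ k * (1 / norm (w q) ^ k)"]
  have "((\<lambda>z. \<Sum>\<^sub>\<infinity>q. 1 / (z - w q) ^ k) has_field_derivative (\<Sum>\<^sub>\<infinity>q. - of_nat k * (1 / (z - w q) ^ Suc k))) (at z)"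
    by (rule L) (assumption | rule le sm d z)+
  thus "(eis k has_field_derivative - of_nat k * eis (Suc k) z) (at z)"
    unfolding infsum_cmult_right' eis_def[abs_def] .
qed

lemma has_field_derivative_wp:
  assumes z: "z \<notin> range w"
  shows "(wp has_field_derivative - 2 * eis 3 z) (at z)"
proof -
  \<comment> \<open>Over a common denominator the numerator is \<open>z (2 w - z)\<close>, of norm
    at most \<open>R * 5/2 * norm w\<close>, and the denominator is at least
    \<open>norm w ^ 4 / 4\<close>; this gives the 10.\<close>
  have le: "norm (1 / (z - w q) ^ 2 - 1 / w q ^ 2) \<le> 10 * R * (1 / norm (w q) ^ 3)"
    if "0 < R" "2 * R \<le> norm (w q)" "norm z \<le> R" for q z R
  proof -
    have w: "norm (w q) > 0" using that by linarith
    have h: "norm (w q) / 2 \<le> norm (z - w q)" using that by (intro half_norm_le) auto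
    hence zw: "z \<noteq> w q" "w q \<noteq> 0" using w by auto
    have "1 / (z - w q) ^ 2 - 1 / w q ^ 2 = z * (2 * w q - z) / ((w q)\<^sup>2 * (z - w q)\<^sup>2)"
      using zw by (simp add: divide_simps) (simp add: algebra_simps power2_eq_square)
    hence "norm (1 / (z - w q) ^ 2 - 1 / w q ^ 2) = norm z * norm (2 * w q - z) / ((norm (w q))\<^sup>2 * (norm (z - w q))\<^sup>2)"
      by (simp add: norm_divide norm_mult norm_power)
    also have "\<dots> \<le> R * (5/2 * norm (w q)) / ((norm (w q))\<^sup>2 * (norm (w q) / 2)\<^sup>2)"
    proof (intro frac_le mult_mono power_mono)
      have "norm (2 * w q - z) \<le> norm (2 * w q) + norm z" by (rule norm_triangle_ineq4)
      thus "norm (2 * w q - z) \<le> 5/2 * norm (w q)" using that by (simp add: norm_mult)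
      show "0 < (norm (w q))\<^sup>2 * (norm (w q) / 2)\<^sup>2" using w by (intro mult_pos_pos zero_less_power) auto
    qed (use that h w in auto)
    also have "\<dots> = 10 * R * (1 / norm (w q) ^ 3)"
      using w by (simp add: field_simps power2_eq_square power3_eq_cube)
    finally show ?thesis .
  qed
  have sm: "(\<lambda>q. 10 * R * (1 / norm (w q) ^ 3)) summable_on A" for A R
    by (intro summable_on_cmult_right summable_norm_w) auto
  have d: "((\<lambda>z. 1 / (z - w q) ^ 2 - 1 / w q ^ 2) has_field_derivative - 2 * (1 / (z - w q) ^ 3)) (at z)"
    if "z \<noteq> w q" for q z
    using DERIV_diff[OF DERIV_one_over_power[OF that, of 2] DERIV_const] by (simp add: eval_nat_numeral)
  note L = lattice_sum_has_derivative[where f = "\<lambda>q z. 1 / (z - w q) ^ 2 - 1 / w q ^ 2"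
      and f' = "\<lambda>q z. - 2 * (1 / (z - w q) ^ 3)" and M = "\<lambda>R q. 10 * R * (1 / norm (w q) ^ 3)"]
  have "((\<lambda>z. \<Sum>\<^sub>\<infinity>q. 1 / (z - w q) ^ 2 - 1 / w q ^ 2) has_field_derivative (\<Sum>\<^sub>\<infinity>q. - 2 * (1 / (z - w q) ^ 3))) (at z)"
    by (rule L) (assumption | rule le sm d z)+
  thus "(wp has_field_derivative - 2 * eis 3 z) (at z)"
    unfolding infsum_cmult_right' wp_def[abs_def] eis_def .
qed


section \<open>Parity, conjugation and periods\<close>

lemma range_w_uminus: "- z \<in> range w \<longleftrightarrow> z \<in> range w"
  by (metis (no_types, opaque_lifting) add.inverse_inverse rangeE rangeI w_minus)

lemma range_w_add: "z + w p \<in> range w \<longleftrightarrow> z \<in> range w"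
  by (metis (no_types, opaque_lifting) add_diff_cancel_right' rangeE rangeI w_add w_diff)

lemma eis_add_period: "eis k (z + w p) = eis k z"
  unfolding eis_def
  by (rule infsum_reindex_bij_witness[where i = "\<lambda>q. q + p" and j = "\<lambda>q. q - p"])
     (auto simp: w_diff algebra_simps)

lemma eis_uminus: "eis k (- z) = (- 1) ^ k * eis k z"
proof -
  have "eis k (- z) = (\<Sum>\<^sub>\<infinity>q. (- 1) ^ k * (1 / (z - w q) ^ k))"
    unfolding eis_def
  proof (rule infsum_reindex_bij_witness[where i = uminus and j = uminus])
    fix q
    have "- z - w q = - (z - w (- q))" by (simp add: w_minus)
    hence "(- z - w q) ^ k = (- 1) ^ k * (z - w (- q)) ^ k" by (metis power_minus)
    thus "(- 1) ^ k * (1 / (z - w (- q)) ^ k) = 1 / (- z - w q) ^ k"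
      by (cases "even k") auto
  qed auto
  thus ?thesis by (simp only: infsum_cmult_right' eis_def)
qed

lemma wp_uminus: "wp (- z) = wp z"
  unfolding wp_def
proof (rule infsum_reindex_bij_witness[where i = uminus and j = uminus])
  fix q
  have "(- z - w q)\<^sup>2 = (z - w (- q))\<^sup>2" "(w (- q))\<^sup>2 = (w q)\<^sup>2"
    by (simp_all add: w_minus power2_eq_square algebra_simps)
  thus "1 / (z - w (- q))\<^sup>2 - 1 / (w (- q))\<^sup>2 = 1 / (- z - w q)\<^sup>2 - 1 / (w q)\<^sup>2" by simp
qed auto

lemma cnj_w': "cnj (w q) = w (fst q, - snd q)"
  by (cases q) (simp add: cnj_w)

lemma cnj_eis: "cnj (eis k z) = eis k (cnj z)"
  unfolding eis_def infsum_cnj[symmetric]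
  by (rule infsum_reindex_bij_witness[where i = "\<lambda>q. (fst q, - snd q)" and j = "\<lambda>q. (fst q, - snd q)"])
     (auto simp: cnj_w')

lemma cnj_wp: "cnj (wp z) = wp (cnj z)"
  unfolding wp_def infsum_cnj[symmetric]
  by (rule infsum_reindex_bij_witness[where i = "\<lambda>q. (fst q, - snd q)" and j = "\<lambda>q. (fst q, - snd q)"])
     (auto simp: cnj_w')

lemma open_complement_lattice: "open (- range w)"
  unfolding open_contains_ball
proof
  fix z assume z: "z \<in> - range w"
  define A where "A = w ` {q. norm (w q) < norm z + 1}"
  have "finite A" unfolding A_def by (intro finite_imageI finite_norm_w_less)
  hence "open (ball 0 (norm z + 1) - A)" by (intro open_Diff open_ball finite_imp_closed)
  moreover have "z \<in> ball 0 (norm z + 1) - A" using z by (auto simp: A_def)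
  ultimately obtain e where e: "e > 0" "ball z e \<subseteq> ball 0 (norm z + 1) - A"
    by (meson open_contains_ball)
  have "ball 0 (norm z + 1) - A \<subseteq> - range w" by (auto simp: A_def)
  thus "\<exists>e>0. ball z e \<subseteq> - range w" using e by blast
qed

lemma connected_complement_lattice: "connected (- range w)"
  by (intro path_connected_imp_connected path_connected_complement_countable) auto

text \<open>Reindexing alone does not give periodicity, because of the subtracted terms
  \<open>1 / w^2\<close>. But the derivative is periodic, so the difference is constant on the
  connected complement of the lattice, and evenness makes it 0 at \<open>- w p / 2\<close>. This
  needs the half-period to be no lattice point, which holds for the two generators.\<close>

lemma wp_add_period_half:
  assumes h: "w p / 2 \<notin> range w" and z: "z \<notin> range w"
  shows "wp (z + w p) = wp z"
proof -
  have "(\<lambda>z. wp (z + w p) - wp z) constant_on (- range w)"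
  proof (rule has_field_derivative_0_imp_constant_on)
    fix u assume u: "u \<in> - range w"
    have "(wp has_field_derivative - 2 * eis 3 (u + w p)) (at (u + w p))"
      by (rule has_field_derivative_wp) (use u in \<open>simp add: range_w_add\<close>)
    hence "((\<lambda>z. wp (z + w p)) has_field_derivative - 2 * eis 3 (u + w p) * 1) (at u)"
      by (rule DERIV_chain2) (auto intro!: derivative_eq_intros)
    from DERIV_diff[OF this has_field_derivative_wp[of u]] u
    show "((\<lambda>z. wp (z + w p) - wp z) has_field_derivative 0) (at u)"
      by (simp add: eis_add_period)
  qed (auto intro: open_complement_lattice connected_complement_lattice)
  then obtain c where c: "\<And>u. u \<notin> range w \<Longrightarrow> wp (u + w p) - wp u = c"
    by (auto simp: constant_on_def)
  have "wp (- (w p / 2) + w p) - wp (- (w p / 2)) = c"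
    by (rule c) (use h in \<open>simp only: range_w_uminus\<close>, simp)
  moreover have "- (w p / 2) + w p = w p / 2" by simp
  ultimately have "c = 0" by (simp add: wp_uminus)
  thus ?thesis using c[OF z] by simp
qed

lemma half_notin_range_w:
  assumes "odd (fst p) \<or> odd (snd p)"
  shows "w p / 2 \<notin> range w"
proof
  assume "w p / 2 \<in> range w"
  then obtain q where "w p / 2 = w q" by auto
  hence "w p = w (q + q)" by (simp add: w_add)
  hence "p = q + q" by (simp add: w_eq_iff)
  thus False using assms by auto
qed

lemma wp_add_period1: "z \<notin> range w \<Longrightarrow> wp (z + w (1, 0)) = wp z"
  and wp_add_period2: "z \<notin> range w \<Longrightarrow> wp (z + w (0, 1)) = wp z"
  by (rule wp_add_period_half; simp add: half_notin_range_w)+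

section \<open>Eisenstein sums and expansions at the origin\<close>

definition S :: "nat \<Rightarrow> complex" where "S k = (\<Sum>\<^sub>\<infinity>q. 1 / w q ^ k)"

lemma S_odd: "odd k \<Longrightarrow> S k = 0"
  using eis_uminus[of k 0] by (simp add: eis_def S_def power_minus_odd infsum_uminus)

lemma cnj_S: "cnj (S k) = S k"
proof -
  have "S k = (- 1) ^ k * eis k 0"
  proof -
    have "1 / (0 - w q) ^ k = (-1) ^ k * (1 / w q ^ k)" for q
      by (cases "even k") auto
    hence "eis k 0 = (-1) ^ k * S k" by (simp only: eis_def S_def infsum_cmult_right')
    thus ?thesis by (cases "even k") auto
  qed
  thus ?thesis by (simp add: cnj_eis)
qed

text \<open>The term at the origin, excluded in \<open>lattice_g2\<close>, is
  \<open>1 / 0 = 0\<close> in \<open>S 4\<close>.\<close>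

lemma lattice_g2_eq: "lattice_g2 (of_real a) (\<i> * of_real b) = 60 * S 4"
  unfolding lattice_g2_def S_def w_def
  by (intro arg_cong2[of _ _ _ _ "(*)"] refl infsum_cong_neutral) (auto simp: case_prod_unfold)

lemma lattice_g3_eq: "lattice_g3 (of_real a) (\<i> * of_real b) = 140 * S 6"
  unfolding lattice_g3_def S_def w_def
  by (intro arg_cong2[of _ _ _ _ "(*)"] refl infsum_cong_neutral) (auto simp: case_prod_unfold)

lemma near_0_notin: "0 < norm z \<Longrightarrow> norm z < r0 \<Longrightarrow> z \<notin> range w"
proof
  assume z: "0 < norm z" "norm z < r0" and "z \<in> range w"
  then obtain q where q: "z = w q" by auto
  hence "q \<noteq> 0" using z by auto
  from norm_w_lower(2)[OF this] show False using z q r0_pos by simp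
qed

text \<open>The remainders after the terms of order \<open>z\<^sup>4\<close> and \<open>z\<^sup>3\<close> of the geometric expansions of
  \<open>1 / (z - w)\<^sup>2 - 1 / w\<^sup>2\<close> and \<open>- 2 / (z - w)\<^sup>3\<close>, divided by \<open>z\<^sup>5\<close> and \<open>z\<^sup>4\<close>.\<close>

lemma remainder_bounds:
  assumes z: "norm z < r0"
  shows "norm ((6 * w q - 5 * z) / (w q ^ 6 * (z - w q)\<^sup>2)) \<le> 34 * (1 / norm (w q) ^ 7)"
    and "norm ((30 * (w q)\<^sup>2 - 48 * w q * z + 20 * z\<^sup>2) / (w q ^ 6 * (w q - z) ^ 3)) \<le> 472 * (1 / norm (w q) ^ 7)"
proof -
  define n where "n = norm (w q)"
  show "norm ((6 * w q - 5 * z) / (w q ^ 6 * (z - w q)\<^sup>2)) \<le> 34 * (1 / norm (w q) ^ 7)"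
  proof (cases "q = 0")
    case False
    have n: "n > 0" "2 * norm z \<le> n" using norm_w_lower(2)[OF False] z r0_pos by (auto simp: n_def)
    have h: "n / 2 \<le> norm (z - w q)" unfolding n_def by (rule half_norm_le) (use n n_def in auto)
    have "norm (6 * w q - 5 * z) \<le> norm (6 * w q) + norm (5 * z)" by (rule norm_triangle_ineq4)
    also have "\<dots> \<le> 17/2 * n" using n by (simp add: norm_mult n_def)
    finally have 1: "norm (6 * w q - 5 * z) \<le> 17/2 * n" .
    have "norm ((6 * w q - 5 * z) / (w q ^ 6 * (z - w q)\<^sup>2)) = norm (6 * w q - 5 * z) / (n ^ 6 * norm (z - w q) ^ 2)"
      by (simp add: norm_divide norm_mult norm_power n_def)
    also have "\<dots> \<le> (17/2 * n) / (n ^ 6 * (n / 2) ^ 2)"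
      using 1 h n by (intro frac_le mult_left_mono power_mono mult_pos_pos zero_less_power) auto
    also have "\<dots> = 34 * (1 / n ^ 7)" using n by (simp add: field_simps power_numeral_reduce)
    finally show ?thesis by (simp add: n_def)
  qed simp
  show "norm ((30 * (w q)\<^sup>2 - 48 * w q * z + 20 * z\<^sup>2) / (w q ^ 6 * (w q - z) ^ 3)) \<le> 472 * (1 / norm (w q) ^ 7)"
  proof (cases "q = 0")
    case False
    have n: "n > 0" "2 * norm z \<le> n" using norm_w_lower(2)[OF False] z r0_pos by (auto simp: n_def)
    have h: "n / 2 \<le> norm (w q - z)" unfolding n_def norm_minus_commute[of "w q" z]
      by (rule half_norm_le) (use n n_def in auto)
    have "norm (30 * (w q)\<^sup>2 - 48 * w q * z + 20 * z\<^sup>2) \<le> norm (30 * (w q)\<^sup>2) + norm (48 * w q * z) + norm (20 * z\<^sup>2)"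
      by (intro order_trans[OF norm_triangle_ineq] add_right_mono norm_triangle_ineq4)
    also have "\<dots> = 30 * n\<^sup>2 + 48 * n * norm z + 20 * (norm z)\<^sup>2"
      by (simp add: norm_mult norm_power n_def)
    also have "\<dots> \<le> 30 * n\<^sup>2 + 48 * n * (n / 2) + 20 * (n / 2)\<^sup>2"
      using n by (intro add_mono mult_left_mono power_mono) auto
    also have "\<dots> = 59 * n\<^sup>2" by (simp add: power2_eq_square)
    finally have 1: "norm (30 * (w q)\<^sup>2 - 48 * w q * z + 20 * z\<^sup>2) \<le> 59 * n\<^sup>2" .
    have "norm ((30 * (w q)\<^sup>2 - 48 * w q * z + 20 * z\<^sup>2) / (w q ^ 6 * (w q - z) ^ 3))
        = norm (30 * (w q)\<^sup>2 - 48 * w q * z + 20 * z\<^sup>2) / (n ^ 6 * norm (w q - z) ^ 3)"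
      by (simp add: norm_divide norm_mult norm_power n_def)
    also have "\<dots> \<le> (59 * n\<^sup>2) / (n ^ 6 * (n / 2) ^ 3)"
      using 1 h n by (intro frac_le mult_left_mono power_mono mult_pos_pos zero_less_power) auto
    also have "\<dots> = 472 * (1 / n ^ 7)" using n by (simp add: field_simps power_numeral_reduce)
    finally show ?thesis by (simp add: n_def)
  qed simp
qed

lemma has_sum_S: "3 \<le> k \<Longrightarrow> ((\<lambda>q. 1 / w q ^ k) has_sum S k) UNIV"
  unfolding S_def by (intro has_sum_infsum summable_w)

text \<open>The orders are the least that serve the differential equation: multiplied by the poles
  \<open>1 / z^3\<close> of the derivative and \<open>1 / z^4\<close> of the square of \<wp>, the
  remainders \<open>z^4 K'\<close> and \<open>z^5 K\<close> are still \<open>O(z)\<close>. Sums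
  \<open>S k\<close> with odd \<open>k\<close> vanish by symmetry.\<close>

lemma laurent_expansion:
  obtains C K K' where
    "\<And>z. 0 < norm z \<Longrightarrow> norm z < r0 \<Longrightarrow> wp z = 1 / z\<^sup>2 + (3 * S 4 * z\<^sup>2 + 5 * S 6 * z ^ 4 + z ^ 5 * K z)"
    "\<And>z. 0 < norm z \<Longrightarrow> norm z < r0 \<Longrightarrow> - 2 * eis 3 z = - 2 / z ^ 3 + (6 * S 4 * z + 20 * S 6 * z ^ 3 + z ^ 4 * K' z)"
    "\<And>z. norm z < r0 \<Longrightarrow> norm (K z) \<le> C" "\<And>z. norm z < r0 \<Longrightarrow> norm (K' z) \<le> C"
proof -
  define k where "k z q = (6 * w q - 5 * z) / (w q ^ 6 * (z - w q)\<^sup>2)" for z q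
  define k' where "k' z q = (30 * (w q)\<^sup>2 - 48 * w q * z + 20 * z\<^sup>2) / (w q ^ 6 * (w q - z) ^ 3)" for z q
  define K where "K z = infsum (k z) UNIV" for z
  define K' where "K' z = infsum (k' z) UNIV" for z
  define C0 where "C0 = infsum (\<lambda>q. 1 / norm (w q) ^ 7) UNIV"
  have C0: "((\<lambda>q. 1 / norm (w q) ^ 7) has_sum C0) UNIV"
    unfolding C0_def by (intro has_sum_infsum summable_norm_w) auto
  have C0_nonneg: "C0 \<ge> 0" unfolding C0_def by (rule infsum_nonneg) auto
  have K: "(k z has_sum K z) UNIV" "norm (K z) \<le> 34 * C0" if z: "norm z < r0" for z
  proof -
    show 1: "(k z has_sum K z) UNIV" unfolding K_def
      by (rule has_sum_infsum, rule abs_summable_summable, rule Infinite_Sum.abs_summable_on_comparison_test'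
            [OF has_sum_imp_summable[OF has_sum_cmult_right[OF C0, of 34]]])
         (use remainder_bounds(1)[OF z] in \<open>simp add: k_def\<close>)
    show "norm (K z) \<le> 34 * C0"
      by (rule norm_infsum_le[OF 1 has_sum_cmult_right[OF C0]])
         (use remainder_bounds(1)[OF z] in \<open>simp add: k_def\<close>)
  qed
  have K': "(k' z has_sum K' z) UNIV" "norm (K' z) \<le> 472 * C0" if z: "norm z < r0" for z
  proof -
    show 1: "(k' z has_sum K' z) UNIV" unfolding K'_def
      by (rule has_sum_infsum, rule abs_summable_summable, rule Infinite_Sum.abs_summable_on_comparison_test'
            [OF has_sum_imp_summable[OF has_sum_cmult_right[OF C0, of 472]]])
         (use remainder_bounds(2)[OF z] in \<open>simp add: k'_def\<close>)
    show "norm (K' z) \<le> 472 * C0"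
      by (rule norm_infsum_le[OF 1 has_sum_cmult_right[OF C0]])
         (use remainder_bounds(2)[OF z] in \<open>simp add: k'_def\<close>)
  qed
  \<comment> \<open>The summand at \<open>q = 0\<close> contributes the pole, and nothing
    else.\<close>
  have delta: "((\<lambda>q. if q = 0 then c else 0) has_sum c) UNIV" for c :: complex
    by (rule has_sum_finite_neutralI[of "{0}"]) auto
  have wp: "wp z = 1 / z\<^sup>2 + (3 * S 4 * z\<^sup>2 + 5 * S 6 * z ^ 4 + z ^ 5 * K z)"
    if z: "0 < norm z" "norm z < r0" for z
  proof -
    have "((\<lambda>q. (if q = 0 then 1 / z\<^sup>2 else 0) + (2 * z * (1 / w q ^ 3) + 3 * z\<^sup>2 * (1 / w q ^ 4)
            + 4 * z ^ 3 * (1 / w q ^ 5) + 5 * z ^ 4 * (1 / w q ^ 6) + z ^ 5 * k z q))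
        has_sum (1 / z\<^sup>2 + (2 * z * S 3 + 3 * z\<^sup>2 * S 4 + 4 * z ^ 3 * S 5 + 5 * z ^ 4 * S 6 + z ^ 5 * K z))) UNIV"
      by (intro has_sum_add has_sum_cmult_right delta has_sum_S K z) auto
    moreover have "(if q = 0 then 1 / z\<^sup>2 else 0) + (2 * z * (1 / w q ^ 3) + 3 * z\<^sup>2 * (1 / w q ^ 4)
            + 4 * z ^ 3 * (1 / w q ^ 5) + 5 * z ^ 4 * (1 / w q ^ 6) + z ^ 5 * k z q)
          = 1 / (z - w q) ^ 2 - 1 / w q ^ 2" for q
    proof (cases "q = 0")
      case False
      hence "w q \<noteq> 0" "z - w q \<noteq> 0" using near_0_notin[OF z] by auto
      have id: "2 * z / W ^ 3 + 3 * z\<^sup>2 / W ^ 4 + 4 * z ^ 3 / W ^ 5 + 5 * z ^ 4 / W ^ 6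
             + z ^ 5 * ((6 * W - 5 * z) / (W ^ 6 * V\<^sup>2)) = 1 / V\<^sup>2 - 1 / W\<^sup>2"
        if "W \<noteq> 0" "V \<noteq> 0" "z = W + V" for W V :: complex
        using that(1,2) unfolding that(3)
        by (simp add: divide_simps) (simp add: power_numeral_reduce algebra_simps)
      show ?thesis using id[of "w q" "z - w q"] \<open>w q \<noteq> 0\<close> \<open>z - w q \<noteq> 0\<close> False by (simp add: k_def)
    qed (simp add: k_def)
    ultimately have "((\<lambda>q. 1 / (z - w q) ^ 2 - 1 / w q ^ 2) has_sum
        (1 / z\<^sup>2 + (2 * z * S 3 + 3 * z\<^sup>2 * S 4 + 4 * z ^ 3 * S 5 + 5 * z ^ 4 * S 6 + z ^ 5 * K z))) UNIV"
      by simp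
    from infsumI[OF this] show ?thesis unfolding wp_def by (simp add: S_odd mult_ac)
  qed
  have wp': "- 2 * eis 3 z = - 2 / z ^ 3 + (6 * S 4 * z + 20 * S 6 * z ^ 3 + z ^ 4 * K' z)"
    if z: "0 < norm z" "norm z < r0" for z
  proof -
    have "((\<lambda>q. (if q = 0 then - 2 / z ^ 3 else 0) + (2 * (1 / w q ^ 3) + 6 * z * (1 / w q ^ 4)
            + 12 * z ^ 2 * (1 / w q ^ 5) + 20 * z ^ 3 * (1 / w q ^ 6) + z ^ 4 * k' z q))
        has_sum (- 2 / z ^ 3 + (2 * S 3 + 6 * z * S 4 + 12 * z ^ 2 * S 5 + 20 * z ^ 3 * S 6 + z ^ 4 * K' z))) UNIV"
      by (intro has_sum_add has_sum_cmult_right delta has_sum_S K' z) auto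
    moreover have "(if q = 0 then - 2 / z ^ 3 else 0) + (2 * (1 / w q ^ 3) + 6 * z * (1 / w q ^ 4)
            + 12 * z ^ 2 * (1 / w q ^ 5) + 20 * z ^ 3 * (1 / w q ^ 6) + z ^ 4 * k' z q)
          = - 2 * (1 / (z - w q) ^ 3)" for q
    proof (cases "q = 0")
      case False
      hence "w q \<noteq> 0" "w q - z \<noteq> 0" using near_0_notin[OF z] by auto
      have id: "2 / W ^ 3 + 6 * z / W ^ 4 + 12 * z\<^sup>2 / W ^ 5 + 20 * z ^ 3 / W ^ 6
             + z ^ 4 * ((30 * W\<^sup>2 - 48 * W * z + 20 * z\<^sup>2) / (W ^ 6 * V ^ 3)) = 2 / V ^ 3"
        if "W \<noteq> 0" "V \<noteq> 0" "z = W - V" for W V :: complex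
        using that(1,2) unfolding that(3)
        by (simp add: divide_simps) (simp add: power_numeral_reduce algebra_simps)
      have "- 2 * (1 / (z - w q) ^ 3) = 2 / (w q - z) ^ 3"
        using power_minus_odd[of 3 "w q - z"] by simp
      thus ?thesis using id[of "w q" "w q - z"] \<open>w q \<noteq> 0\<close> \<open>w q - z \<noteq> 0\<close> False by (simp add: k'_def)
    qed (simp add: k'_def)
    ultimately have "((\<lambda>q. - 2 * (1 / (z - w q) ^ 3)) has_sum
        (- 2 / z ^ 3 + (2 * S 3 + 6 * z * S 4 + 12 * z ^ 2 * S 5 + 20 * z ^ 3 * S 6 + z ^ 4 * K' z))) UNIV"
      by simp
    from infsumI[OF this] show ?thesis
      unfolding eis_def infsum_cmult_right' by (simp add: S_odd mult_ac)
  qed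
  show thesis
    by (rule that[of K K' "472 * C0"]) (use wp wp' K(2) K'(2) C0_nonneg in \<open>force+\<close>)
qed

end

text \<open>The inner derivative \<i> exchanges real and imaginary parts. The base point
  \<open>c\<close> is 0 for the imaginary axis and the real half-period for the line through
  it.\<close>

lemma DERIV_along_imaginary:
  assumes "(f has_field_derivative D) (at (c + \<i> * of_real u))"
  shows "((\<lambda>u. Re (f (c + \<i> * of_real u))) has_real_derivative - Im D) (at u)"
    and "((\<lambda>u. Im (f (c + \<i> * of_real u))) has_real_derivative Re D) (at u)"
proof -
  have "((\<lambda>u. c + \<i> * of_real u) has_vector_derivative \<i>) (at u)"
    by (auto intro!: derivative_eq_intros)
  hence "((f \<circ> (\<lambda>u. c + \<i> * of_real u)) has_vector_derivative (\<i> * D)) (at u)"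
    using assms by (rule field_vector_diff_chain_at)
  hence v: "((\<lambda>u. f (c + \<i> * of_real u)) has_vector_derivative (\<i> * D)) (at u)"
    by (simp add: o_def)
  show "((\<lambda>u. Re (f (c + \<i> * of_real u))) has_real_derivative - Im D) (at u)"
    using has_field_derivative_Re[OF v] by simp
  show "((\<lambda>u. Im (f (c + \<i> * of_real u))) has_real_derivative Re D) (at u)"
    using has_field_derivative_Im[OF v] by simp
qed

section \<open>The differential equations of first and second order\<close>

context rect_lattice begin

lemma eventually_near_0: "eventually (\<lambda>z. 0 < norm z \<and> norm z < r0) (at (0::complex))"
  unfolding eventually_at using r0_pos by (intro exI[of _ r0]) auto

lemma principal_parts:
  obtains Y V where
    "\<And>z. 0 < norm z \<Longrightarrow> norm z < r0 \<Longrightarrow> wp z = 1 / z\<^sup>2 + z * Y z" "(Y \<longlongrightarrow> 0) (at 0)"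
    "\<And>z. 0 < norm z \<Longrightarrow> norm z < r0 \<Longrightarrow> - 2 * eis 3 z = - 2 / z ^ 3 + V z" "(V \<longlongrightarrow> 0) (at 0)"
    "((\<lambda>z. (- 2 * eis 3 z)\<^sup>2 - 4 * wp z ^ 3 + 60 * S 4 * wp z + 140 * S 6) \<longlongrightarrow> 0) (at 0)"
proof -
  obtain C K K' where wp: "\<And>z. 0 < norm z \<Longrightarrow> norm z < r0 \<Longrightarrow> wp z = 1 / z\<^sup>2 + (3 * S 4 * z\<^sup>2 + 5 * S 6 * z ^ 4 + z ^ 5 * K z)"
    and wp': "\<And>z. 0 < norm z \<Longrightarrow> norm z < r0 \<Longrightarrow> - 2 * eis 3 z = - 2 / z ^ 3 + (6 * S 4 * z + 20 * S 6 * z ^ 3 + z ^ 4 * K' z)"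
    and K: "\<And>z. norm z < r0 \<Longrightarrow> norm (K z) \<le> C" and K': "\<And>z. norm z < r0 \<Longrightarrow> norm (K' z) \<le> C"
    using laurent_expansion by metis
  have bdd: "((\<lambda>z. z * k z) \<longlongrightarrow> 0) (at 0)" if "\<And>z. norm z < r0 \<Longrightarrow> norm (k z) \<le> C" for k :: "complex \<Rightarrow> complex"
  proof (rule Lim_null_comparison)
    show "eventually (\<lambda>z. norm (z * k z) \<le> norm z * C) (at 0)"
      using eventually_near_0 by eventually_elim (use that in \<open>auto simp: norm_mult intro!: mult_left_mono\<close>)
    show "((\<lambda>z. norm z * C) \<longlongrightarrow> 0) (at (0::complex))" by (auto intro!: tendsto_eq_intros)
  qed
  define k where "k z = z * K z" for z
  define k' where "k' z = z * K' z" for z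
  have k: "(k \<longlongrightarrow> 0) (at 0)" unfolding k_def by (rule bdd[OF K])
  have k': "(k' \<longlongrightarrow> 0) (at 0)" unfolding k'_def by (rule bdd[OF K'])
  define Y where "Y z = 3 * S 4 * z + 5 * S 6 * z ^ 3 + z ^ 3 * k z" for z
  define V where "V z = 6 * S 4 * z + 20 * S 6 * z ^ 3 + z ^ 3 * k' z" for z
  have Y: "(Y \<longlongrightarrow> 0) (at 0)" unfolding Y_def by (auto intro!: tendsto_eq_intros k)
  have V: "(V \<longlongrightarrow> 0) (at 0)" unfolding V_def by (auto intro!: tendsto_eq_intros k')
  have wpY: "wp z = 1 / z\<^sup>2 + z * Y z" if "0 < norm z" "norm z < r0" for z
    unfolding wp[OF that] Y_def k_def by (simp add: power_numeral_reduce algebra_simps)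
  have wpV: "- 2 * eis 3 z = - 2 / z ^ 3 + V z" if "0 < norm z" "norm z < r0" for z
    unfolding wp'[OF that] V_def k'_def by (simp add: power_numeral_reduce algebra_simps)
  have "((\<lambda>z. - 4 * k' z - 12 * k z + (V z)\<^sup>2 - 12 * (Y z)\<^sup>2 - 4 * (z * Y z) ^ 3
             + 60 * S 4 * (z * Y z)) \<longlongrightarrow> 0) (at 0)"
    by (rule tendsto_eq_intros k k' Y V refl)+ simp
  moreover have "eventually (\<lambda>z. - 4 * k' z - 12 * k z + (V z)\<^sup>2 - 12 * (Y z)\<^sup>2 - 4 * (z * Y z) ^ 3
             + 60 * S 4 * (z * Y z)
       = (- 2 * eis 3 z)\<^sup>2 - 4 * wp z ^ 3 + 60 * S 4 * wp z + 140 * S 6) (at 0)"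
    using eventually_near_0
  proof eventually_elim
    case (elim z)
    \<comment> \<open>With \<open>i\<close> for the pole and \<open>z * i = 1\<close> the singular
      parts become polynomials in \<open>i\<close>. The coefficients of \<open>S 4 * i^2\<close> are
      -24 - 36 + 60 = 0 and those of \<open>S 6\<close> are -80 - 60 + 140 = 0, whence the factors
      60 and 140.\<close>
    define i where "i = 1 / z"
    have zi: "z * i = 1" using elim by (auto simp: i_def)
    have iV: "i ^ 3 * V z = 6 * S 4 * i\<^sup>2 + 20 * S 6 + k' z"
    proof -
      have "i ^ 3 * V z = 6 * S 4 * i\<^sup>2 * (z * i) + 20 * S 6 * (z * i) ^ 3 + (z * i) ^ 3 * k' z"
        by (simp add: V_def power_numeral_reduce algebra_simps)
      thus ?thesis by (simp add: zi)
    qed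
    have iY: "i ^ 4 * (z * Y z) = 3 * S 4 * i\<^sup>2 + 5 * S 6 + k z"
    proof -
      have "i ^ 4 * (z * Y z) = 3 * S 4 * i\<^sup>2 * (z * i)\<^sup>2 + 5 * S 6 * (z * i) ^ 4 + (z * i) ^ 4 * k z"
        by (simp add: Y_def power_numeral_reduce algebra_simps)
      thus ?thesis by (simp add: zi)
    qed
    have iYY: "i\<^sup>2 * (z * Y z)\<^sup>2 = (Y z)\<^sup>2"
    proof -
      have "i\<^sup>2 * (z * Y z)\<^sup>2 = (z * i)\<^sup>2 * (Y z)\<^sup>2" by (simp add: power_numeral_reduce algebra_simps)
      thus ?thesis by (simp add: zi)
    qed
    have e1: "- 2 * eis 3 z = - 2 * i ^ 3 + V z" and e2: "wp z = i\<^sup>2 + z * Y z"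
      using wpV[of z] wpY[of z] elim by (simp_all add: i_def power_divide)
    have "(- 2 * eis 3 z)\<^sup>2 - 4 * wp z ^ 3 + 60 * S 4 * wp z + 140 * S 6
       = - 4 * (i ^ 3 * V z) + (V z)\<^sup>2 - 12 * (i ^ 4 * (z * Y z)) - 12 * (i\<^sup>2 * (z * Y z)\<^sup>2)
          - 4 * (z * Y z) ^ 3 + 60 * S 4 * (i\<^sup>2 + z * Y z) + 140 * S 6"
      unfolding e1 e2 by (simp add: power_numeral_reduce algebra_simps)
    also have "\<dots> = - 4 * k' z - 12 * k z + (V z)\<^sup>2 - 12 * (Y z)\<^sup>2 - 4 * (z * Y z) ^ 3
             + 60 * S 4 * (z * Y z)"
      unfolding iV iY iYY by (simp add: algebra_simps)
    finally show ?case by simp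
  qed
  ultimately have "((\<lambda>z. (- 2 * eis 3 z)\<^sup>2 - 4 * wp z ^ 3 + 60 * S 4 * wp z + 140 * S 6) \<longlongrightarrow> 0) (at 0)"
    by (rule Lim_transform_eventually)
  thus thesis using that[OF wpY Y wpV V] by blast
qed

lemma wp_holomorphic: "wp holomorphic_on - range w"
  using has_field_derivative_wp by (auto simp: holomorphic_on_open open_complement_lattice)

lemma eis_holomorphic: "3 \<le> k \<Longrightarrow> eis k holomorphic_on - range w"
  using has_field_derivative_eis by (auto simp: holomorphic_on_open open_complement_lattice)

lemma doubly_periodic:
  fixes F :: "complex \<Rightarrow> 'a"
  assumes 1: "\<And>z. F (z + w (1, 0)) = F z" and 2: "\<And>z. F (z + w (0, 1)) = F z"
  shows "F (z + w q) = F z"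
proof -
  have m: "F (z + w (m, 0)) = F z" for m z
  proof (induction m rule: int_induct[where k = 0])
    case (step1 i)
    have "w (i + 1, 0) = w (i, 0) + w (1, 0)" by (simp add: w_add[symmetric])
    thus ?case using step1 1[of "z + w (i, 0)"] by (simp add: add.assoc)
  next
    case (step2 i)
    have "w (i, 0) = w (i - 1, 0) + w (1, 0)" by (simp add: w_add[symmetric])
    thus ?case using step2 1[of "z + w (i - 1, 0)"] by (simp add: add.assoc)
  qed simp
  have n: "F (z + w (0, n)) = F z" for n z
  proof (induction n rule: int_induct[where k = 0])
    case (step1 i)
    have "w (0, i + 1) = w (0, i) + w (0, 1)" by (simp add: w_add[symmetric])
    thus ?case using step1 2[of "z + w (0, i)"] by (simp add: add.assoc)
  next
    case (step2 i)
    have "w (0, i) = w (0, i - 1) + w (0, 1)" by (simp add: w_add[symmetric])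
    thus ?case using step2 2[of "z + w (0, i - 1)"] by (simp add: add.assoc)
  qed simp
  obtain i j where q: "q = (i, j)" by (cases q)
  have "w q = w (i, 0) + w (0, j)" by (simp add: q w_add[symmetric])
  thus ?thesis using m n by (simp add: add.assoc[symmetric])
qed

text \<open>All values occur on one compact period rectangle, so the function is bounded and
  Liouville's theorem applies.\<close>

lemma doubly_periodic_entire_constant:
  assumes hol: "F holomorphic_on UNIV" and per: "\<And>z q. F (z + w q) = F z"
  shows "F constant_on UNIV"
proof (rule Liouville_theorem[OF hol])
  let ?B = "cbox 0 (Complex (2 * a) (2 * b))"
  have "range F \<subseteq> F ` ?B"
  proof safe
    fix z
    define m n where "m = \<lfloor>Re z / (2 * a)\<rfloor>" and "n = \<lfloor>Im z / (2 * b)\<rfloor>"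
    have "of_int m \<le> Re z / (2 * a)" "Re z / (2 * a) \<le> of_int m + 1"
         "of_int n \<le> Im z / (2 * b)" "Im z / (2 * b) \<le> of_int n + 1"
      unfolding m_def n_def by linarith+
    hence "z - w (m, n) \<in> ?B"
      using a_pos b_pos by (auto simp: in_cbox_complex_iff Re_w Im_w field_simps)
    moreover have "F z = F (z - w (m, n))" using per[of "z - w (m, n)" "(m, n)"] by simp
    ultimately show "F z \<in> F ` ?B" by blast
  qed
  moreover have "compact (F ` ?B)"
    by (intro compact_continuous_image compact_cbox holomorphic_on_imp_continuous_on
        holomorphic_on_subset[OF hol]) auto
  ultimately show "bounded (range F)" using bounded_subset compact_imp_bounded by blast
qed

text \<open>The difference of the two sides is doubly periodic and tends to 0 at the origin. Its
  singularities at the lattice points are therefore removable, it extends to an entire function, and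
  that function is constantly 0.\<close>

lemma wp_ode:
  assumes "z \<notin> range w"
  shows "(- 2 * eis 3 z)\<^sup>2 = 4 * wp z ^ 3 - 60 * S 4 * wp z - 140 * S 6"
proof -
  define f where "f z = (- 2 * eis 3 z)\<^sup>2 - 4 * wp z ^ 3 + 60 * S 4 * wp z + 140 * S 6" for z
  \<comment> \<open>The value 0 on the lattice is the limit at the origin. It makes \<open>F\<close>
    a total function that is periodic at every point, so removability at 0 carries over to all
    lattice points.\<close>
  define F where "F z = (if z \<in> range w then 0 else f z)" for z
  have f_hol: "f holomorphic_on - range w"
    unfolding f_def by (intro holomorphic_intros wp_holomorphic eis_holomorphic) auto
  have per: "F (z + w q) = F z" for z q
    by (rule doubly_periodic)
       (auto simp: F_def f_def range_w_add eis_add_period wp_add_period1 wp_add_period2)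
  have F_hol1: "F holomorphic_on - range w"
    using f_hol by (rule holomorphic_transform) (auto simp: F_def)
  have lim: "(F \<longlongrightarrow> 0) (at 0)"
  proof (rule Lim_transform_eventually)
    show "(f \<longlongrightarrow> 0) (at 0)" unfolding f_def by (rule principal_parts)
    show "eventually (\<lambda>z. f z = F z) (at 0)"
      using eventually_near_0 by eventually_elim (simp add: F_def near_0_notin)
  qed
  have F0: "F 0 = 0" using rangeI[of w 0] by (simp add: F_def)
  have "F holomorphic_on ball 0 r0"
  proof (rule no_isolated_singularity'[where K = "{0}"])
    show "(F \<longlongrightarrow> F z) (at z within ball 0 r0)" if "z \<in> {0}" for z
      using that lim F0 by (auto intro: tendsto_within_subset)
    show "F holomorphic_on ball 0 r0 - {0}"
    proof (rule holomorphic_on_subset[OF F_hol1])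
      show "ball 0 r0 - {0} \<subseteq> - range w"
        using near_0_notin by (metis ComplI DiffE mem_ball_0 singletonI subsetI zero_less_norm_iff)
    qed
  qed auto
  hence d0: "F field_differentiable at 0"
    using r0_pos by (auto intro: holomorphic_on_imp_differentiable_at)
  have "F holomorphic_on UNIV"
    unfolding holomorphic_on_def
  proof
    fix z :: complex
    show "F field_differentiable at z within UNIV"
    proof (cases "z \<in> range w")
      case False
      thus ?thesis using F_hol1 open_complement_lattice
        by (auto intro: holomorphic_on_imp_differentiable_at)
    next
      case True
      then obtain q where q: "z = w q" by auto
      have "((\<lambda>u. F (u - w q)) has_field_derivative deriv F 0 * 1) (at z)"
        by (rule DERIV_chain2[of F])
           (use d0 in \<open>auto simp: q field_differentiable_derivI intro!: derivative_eq_intros\<close>)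
      moreover have "(\<lambda>u. F (u - w q)) = F" using per[of "_ - w q" q] by auto
      ultimately show ?thesis by (auto simp: field_differentiable_def)
    qed
  qed
  from doubly_periodic_entire_constant[OF this per] have "F z = F 0"
    by (auto simp: constant_on_def)
  thus ?thesis using assms F0 by (simp add: F_def f_def algebra_simps)
qed

lemma eventually_wp_nonzero: "eventually (\<lambda>z. wp z \<noteq> 0 \<and> eis 3 z \<noteq> 0) (at 0)"
proof -
  obtain Y V where wp: "\<And>z. 0 < norm z \<Longrightarrow> norm z < r0 \<Longrightarrow> wp z = 1 / z\<^sup>2 + z * Y z" and Y: "(Y \<longlongrightarrow> 0) (at 0)"
    and wp': "\<And>z. 0 < norm z \<Longrightarrow> norm z < r0 \<Longrightarrow> - 2 * eis 3 z = - 2 / z ^ 3 + V z" and V: "(V \<longlongrightarrow> 0) (at 0)"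
    and "((\<lambda>z. (- 2 * eis 3 z)\<^sup>2 - 4 * wp z ^ 3 + 60 * S 4 * wp z + 140 * S 6) \<longlongrightarrow> 0) (at 0)"
    by (rule principal_parts, rule that) blast+
  have "((\<lambda>z. 1 + z ^ 3 * Y z) \<longlongrightarrow> 1) (at 0)" "((\<lambda>z. - 2 + z ^ 3 * V z) \<longlongrightarrow> - 2) (at 0)"
    by (auto intro!: tendsto_eq_intros Y V)
  from tendsto_imp_eventually_ne[OF this(1), of 0] tendsto_imp_eventually_ne[OF this(2), of 0]
  have "eventually (\<lambda>z. 1 + z ^ 3 * Y z \<noteq> 0) (at 0)" "eventually (\<lambda>z. - 2 + z ^ 3 * V z \<noteq> 0) (at 0)"
    by simp_all
  thus ?thesis using eventually_near_0
  proof eventually_elim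
    case (elim z)
    have z: "z \<noteq> 0" using elim by auto
    have "z\<^sup>2 * wp z = 1 + z ^ 3 * Y z"
      using wp[of z] elim z by (simp add: algebra_simps power2_eq_square power3_eq_cube)
    moreover have "z ^ 3 * (- 2 * eis 3 z) = - 2 + z ^ 3 * V z"
      unfolding wp'[OF conjunct1[OF elim(3)] conjunct2[OF elim(3)]] using z by (simp add: algebra_simps)
    ultimately show ?case using elim by auto
  qed
qed

text \<open>Differentiating \<open>wp_ode\<close> gives the identity multiplied by the derivative of
  \<wp>. That factor is nonzero near the pole, so it can be cancelled there; analytic continuation
  extends the result to the complement of the lattice, including the zeros of the
  derivative.\<close>

lemma wp_ode2:
  assumes "z \<notin> range w"
  shows "6 * eis 4 z = 6 * (wp z)\<^sup>2 - 30 * S 4"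
proof -
  let ?X = "\<lambda>z. 6 * eis 4 z" and ?Y = "\<lambda>z. 6 * (wp z)\<^sup>2 - 30 * S 4"
  obtain d where d: "d > 0" "\<And>z. z \<noteq> 0 \<Longrightarrow> norm z < d \<Longrightarrow> eis 3 z \<noteq> 0"
    using eventually_wp_nonzero unfolding eventually_at by auto
  define s where "s = ball 0 (min d r0) - {0 :: complex}"
  have s: "z \<notin> range w" "eis 3 z \<noteq> 0" if "z \<in> s" for z
    using that d near_0_notin[of z] by (auto simp: s_def)
  have eq: "?X z = ?Y z" if z: "z \<in> s" for z
  proof -
    have z': "z \<in> - range w" using s z by simp
    have D: "((\<lambda>z. (- 2 * eis 3 z)\<^sup>2 - (4 * wp z ^ 3 - 60 * S 4 * wp z - 140 * S 6)) has_field_derivative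
       2 * (- 2 * eis 3 z) * (6 * eis 4 z) - (12 * (wp z)\<^sup>2 * (- 2 * eis 3 z) - 60 * S 4 * (- 2 * eis 3 z))) (at z)"
      using z' by (auto intro!: derivative_eq_intros has_field_derivative_eis has_field_derivative_wp)
    have "((\<lambda>z. 0) has_field_derivative
       2 * (- 2 * eis 3 z) * (6 * eis 4 z) - (12 * (wp z)\<^sup>2 * (- 2 * eis 3 z) - 60 * S 4 * (- 2 * eis 3 z))) (at z)"
      by (rule has_field_derivative_transform_within_open[OF D open_complement_lattice z'])
         (use wp_ode in simp)
    hence "2 * (- 2 * eis 3 z) * (6 * eis 4 z) - (12 * (wp z)\<^sup>2 * (- 2 * eis 3 z) - 60 * S 4 * (- 2 * eis 3 z)) = 0"
      using DERIV_unique DERIV_const by blast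
    hence "- 4 * eis 3 z * (6 * eis 4 z - (6 * (wp z)\<^sup>2 - 30 * S 4)) = 0"
      by (simp add: algebra_simps)
    thus ?thesis using s(2)[OF z] by simp
  qed
  have "of_real (min d r0 / 2) \<in> s" using d r0_pos by (auto simp: s_def min_def)
  hence ne: "s \<noteq> {}" by blast
  show ?thesis
  proof (rule analytic_continuation_open[of s "- range w" ?X ?Y])
    show "open s" by (auto simp: s_def intro!: open_Diff)
    show "s \<subseteq> - range w" using s(1) by blast
    show "?X holomorphic_on - range w" "?Y holomorphic_on - range w"
      by (intro holomorphic_intros wp_holomorphic eis_holomorphic; simp)+
  qed (use ne eq assms open_complement_lattice connected_complement_lattice in blast)+
qed

section \<open>Real restrictions and critical points at half-periods\<close>

lemma eis3_half_period: "eis 3 (w p / 2) = 0"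
proof -
  have "eis 3 (w p / 2) = eis 3 (- (w p / 2) + w p)" by simp
  also have "\<dots> = - eis 3 (w p / 2)" by (simp only: eis_add_period eis_uminus) simp
  finally show ?thesis by simp
qed

lemma S_real: "S k = of_real (Re (S k))"
  using cnj_S[of k] by (simp add: complex_eq_iff)

lemma imaginary_half_period:
  fixes x :: real
  assumes x: "0 < x" "x < 1"
    and g2: "lattice_g2 (of_real a) (\<i> * of_real b) = of_real (48 * (9 - 8 * x))"
    and g3: "lattice_g3 (of_real a) (\<i> * of_real b) = of_real (64 * (36 * x - 27 - 8 * x\<^sup>2))"
  shows "b = pi / (6 * sqrt 2) * hyp2F1 (1/3) (2/3) 1 x"
proof -
  let ?z = "\<lambda>u. \<i> * complex_of_real u"
  have S4: "60 * S 4 = of_real (48 * (9 - 8 * x))" and S6: "140 * S 6 = of_real (64 * (36 * x - 27 - 8 * x\<^sup>2))"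
    using g2 g3 by (simp_all only: lattice_g2_eq lattice_g3_eq)
  have z: "?z u \<notin> range w" if u: "0 < u" "u \<le> b" for u
  proof
    assume "?z u \<in> range w"
    then obtain q where "?z u = w q" by auto
    hence "u = 2 * real_of_int (snd q) * b" by (simp add: complex_eq_iff Im_w)
    hence "0 < 2 * real_of_int (snd q) * b" "(2 * real_of_int (snd q)) * b \<le> 1 * b" using u by auto
    hence "0 < 2 * real_of_int (snd q)" "2 * real_of_int (snd q) \<le> 1"
      using b_pos by (simp add: zero_less_mult_iff, simp only: mult_le_cancel_right_pos)
    hence "0 < snd q" "snd q < 1" by simp_all
    thus False by simp
  qed
  define p where "p u = - Re (wp (?z u))" for u
  define p1 where "p1 u = Im (- 2 * eis 3 (?z u))" for u
  \<comment> \<open>On the imaginary axis conjugation is negation, so evenness makes \<wp> real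
    there and oddness makes its derivative purely imaginary.\<close>
  have cz: "cnj (?z u) = - ?z u" for u by simp
  have wp_eq: "wp (?z u) = of_real (- p u)" for u
    using cnj_wp[of "?z u"] unfolding cz wp_uminus by (simp add: complex_eq_iff p_def)
  have wp'_eq: "- 2 * eis 3 (?z u) = \<i> * of_real (p1 u)" for u
    using cnj_eis[of 3 "?z u"] unfolding cz eis_uminus by (simp add: complex_eq_iff p1_def)
  show ?thesis
  proof (rule half_period_eq_hyp2F1[OF x b_pos, of p p1])
    fix u assume u: "0 < u" "u \<le> b"
    show "(p has_real_derivative p1 u) (at u)"
      using DERIV_minus[OF DERIV_along_imaginary(1)[of wp "- 2 * eis 3 (?z u)" 0 u]] has_field_derivative_wp[OF z[OF u]]
      by (simp add: p_def[abs_def] p1_def)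
    have "((\<lambda>z. - 2 * eis 3 z) has_field_derivative - 2 * (- of_nat 3 * eis (Suc 3) (?z u))) (at (?z u))"
      by (intro DERIV_cmult has_field_derivative_eis z u) auto
    hence "((\<lambda>z. - 2 * eis 3 z) has_field_derivative 6 * eis 4 (?z u)) (at (0 + ?z u))"
      by (simp add: eval_nat_numeral)
    hence "(p1 has_real_derivative Re (6 * eis 4 (?z u))) (at u)"
      using DERIV_along_imaginary(2)[of "\<lambda>z. - 2 * eis 3 z" "6 * eis 4 (?z u)" 0 u]
      by (simp add: p1_def[abs_def])
    also have "6 * eis 4 (?z u) = of_real (6 * (p u)\<^sup>2 - 24 * (9 - 8 * x))"
      unfolding wp_ode2[OF z[OF u]] wp_eq using S4 by (simp add: complex_eq_iff power2_eq_square)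
    finally show "(p1 has_real_derivative 6 * (p u)\<^sup>2 - 24 * (9 - 8 * x)) (at u)" by simp
    have "of_real (- ((p1 u)\<^sup>2)) = (- 2 * eis 3 (?z u))\<^sup>2"
      unfolding wp'_eq by (simp add: power_mult_distrib)
    also have "\<dots> = of_real (4 * (- p u) ^ 3 - 48 * (9 - 8 * x) * (- p u) - 64 * (36 * x - 27 - 8 * x\<^sup>2))"
      unfolding wp_ode[OF z[OF u]] wp_eq S4 S6 by simp
    finally have "- ((p1 u)\<^sup>2) = 4 * (- p u) ^ 3 - 48 * (9 - 8 * x) * (- p u) - 64 * (36 * x - 27 - 8 * x\<^sup>2)"
      by (simp only: of_real_eq_iff)
    thus "(p1 u)\<^sup>2 = 4 * p u ^ 3 - 48 * (9 - 8 * x) * p u + 64 * (36 * x - 27 - 8 * x\<^sup>2)"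
      by (simp add: power_minus_odd)
  next
    obtain Y V where Y: "\<And>z. 0 < norm z \<Longrightarrow> norm z < r0 \<Longrightarrow> wp z = 1 / z\<^sup>2 + z * Y z" "(Y \<longlongrightarrow> 0) (at 0)"
      and "\<And>z. 0 < norm z \<Longrightarrow> norm z < r0 \<Longrightarrow> - 2 * eis 3 z = - 2 / z ^ 3 + V z" "(V \<longlongrightarrow> 0) (at 0)"
      "((\<lambda>z. (- 2 * eis 3 z)\<^sup>2 - 4 * wp z ^ 3 + 60 * S 4 * wp z + 140 * S 6) \<longlongrightarrow> 0) (at 0)"
      by (rule principal_parts, rule that) blast+
    have lz: "filterlim ?z (at 0) (at_right 0)"
      by (rule filterlim_atI) (auto intro!: tendsto_eq_intros simp: eventually_at_right_field intro: exI[of _ 1])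
    have "((\<lambda>u. - Re (?z u * Y (?z u))) \<longlongrightarrow> - Re (\<i> * of_real 0 * 0)) (at_right 0)"
      by (intro tendsto_intros filterlim_compose[OF Y(2) lz])
    moreover have "filterlim (\<lambda>u::real. inverse u ^ 2) at_top (at_right 0)"
      by (intro filterlim_pow_at_top filterlim_inverse_at_top_right) auto
    ultimately have lim: "filterlim (\<lambda>u. - Re (?z u * Y (?z u)) + inverse u ^ 2) at_top (at_right 0)"
      by (rule filterlim_tendsto_add_at_top)
    have ev: "eventually (\<lambda>u. - Re (?z u * Y (?z u)) + inverse u ^ 2 = p u) (at_right 0)"
    proof -
      have "eventually (\<lambda>u. 0 < u \<and> u < r0) (at_right (0::real))"
        using r0_pos by (auto simp: eventually_at_right_field)
      thus ?thesis
      proof eventually_elim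
        case (elim u)
        hence "wp (?z u) = 1 / (?z u)\<^sup>2 + ?z u * Y (?z u)" by (intro Y) (auto simp: norm_mult)
        moreover have "1 / (?z u)\<^sup>2 = of_real (- (inverse u ^ 2))"
          by (simp add: power_mult_distrib divide_inverse power_inverse)
        ultimately show ?case unfolding p_def by (simp only: plus_complex.sel Re_complex_of_real)
      qed
    qed
    show "filterlim p at_top (at_right 0)"
      using lim unfolding filterlim_cong[OF refl refl ev] .
  next
    have "?z b = w (0, 1) / 2" by (simp add: complex_eq_iff Re_w Im_w)
    hence "eis 3 (?z b) = 0" by (simp only: eis3_half_period)
    thus "p1 b = 0" by (simp add: p1_def)
  qed
qed

text \<open>If \<open>g\<^sub>2 \<le> 0\<close>, then \<open>\<wp>\<close> is concave along the segment from \<open>a\<close> to \<open>a + ib\<close> and has critical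
  points at both ends, so it vanishes there and hence everywhere.\<close>

lemma S4_pos: "0 < Re (S 4)"
proof (rule ccontr)
  assume "\<not> ?thesis"
  hence neg: "Re (S 4) \<le> 0" by simp
  let ?z = "\<lambda>u. of_real a + \<i> * complex_of_real u"
  have z: "?z u \<notin> range w" for u
  proof
    assume "?z u \<in> range w"
    then obtain q where "?z u = w q" by auto
    hence "a = 2 * real_of_int (fst q) * a" by (simp add: complex_eq_iff Re_w)
    hence "real_of_int (2 * fst q) = real_of_int 1" using a_pos by simp
    hence "2 * fst q = 1" by (simp only: of_int_eq_iff)
    thus False by presburger
  qed
  define G where "G u = Re (wp (?z u))" for u
  define G1 where "G1 u = - Im (- 2 * eis 3 (?z u))" for u
  have wp_eq: "wp (?z u) = of_real (G u)" for u
  proof -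
    \<comment> \<open>On the vertical line through \<open>a\<close> conjugation is negation up to a
      period, so \<wp> is real there too.\<close>
    have "cnj (?z u) = - ?z u + w (1, 0)" by (simp add: complex_eq_iff Re_w Im_w)
    hence "cnj (wp (?z u)) = wp (- ?z u + w (1, 0))" by (simp only: cnj_wp)
    also have "\<dots> = wp (- ?z u)" using z[of u] by (intro wp_add_period1) (simp only: range_w_uminus not_False_eq_True)
    also have "\<dots> = wp (?z u)" by (rule wp_uminus)
    finally show ?thesis by (simp add: complex_eq_iff G_def)
  qed
  have dG1: "(G1 has_real_derivative - (6 * (G u)\<^sup>2 - 30 * Re (S 4))) (at u)" for u
  proof -
    have "((\<lambda>z. - 2 * eis 3 z) has_field_derivative - 2 * (- of_nat 3 * eis (Suc 3) (?z u))) (at (?z u))"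
      by (intro DERIV_cmult has_field_derivative_eis z) auto
    hence "((\<lambda>z. - 2 * eis 3 z) has_field_derivative 6 * eis 4 (?z u)) (at (?z u))"
      by (simp add: eval_nat_numeral)
    hence "(G1 has_real_derivative - Re (6 * eis 4 (?z u))) (at u)"
      unfolding G1_def[abs_def] by (intro DERIV_minus DERIV_along_imaginary(2))
    also have "6 * eis 4 (?z u) = of_real (6 * (G u)\<^sup>2 - 30 * Re (S 4))"
      unfolding wp_ode2[OF z] wp_eq by (subst S_real) simp
    finally show ?thesis by simp
  qed
  have anti: "G1 v \<le> G1 u" if "u \<le> v" for u v
  proof (rule DERIV_nonpos_imp_nonincreasing[OF that])
    fix x
    have "- (6 * (G x)\<^sup>2 - 30 * Re (S 4)) \<le> 0" using neg zero_le_power2[of "G x"] by linarith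
    thus "\<exists>y. (G1 has_real_derivative y) (at x) \<and> y \<le> 0" using dG1[of x] by blast
  qed
  have "?z 0 = w (1, 0) / 2" "?z b = w (1, 1) / 2" by (simp_all add: complex_eq_iff Re_w Im_w)
  hence ends: "G1 0 = 0" "G1 b = 0" unfolding G1_def by (simp_all only: eis3_half_period) simp_all
  have G1_0: "G1 u = 0" if "0 \<le> u" "u \<le> b" for u
    using anti[OF that(1)] anti[OF that(2)] ends by simp
  have wp0: "wp (?z u) = 0" if u: "0 < u" "u < b" for u
  proof -
    have "((\<lambda>_. 0) has_real_derivative - (6 * (G u)\<^sup>2 - 30 * Re (S 4))) (at u)"
      by (rule has_field_derivative_transform_within_open[OF dG1, of "{0<..<b}"]) (use u G1_0 in auto)
    hence "6 * (G u)\<^sup>2 - 30 * Re (S 4) = 0" using DERIV_unique DERIV_const by fastforce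
    hence "(G u)\<^sup>2 \<le> 0" using neg by simp
    hence "G u = 0" by simp
    thus ?thesis by (simp add: wp_eq)
  qed
  have lim: "?z (b/2) islimpt (?z ` {0<..<b})"
    unfolding islimpt_approachable
  proof safe
    fix e :: real assume e: "e > 0"
    define u where "u = b/2 + min (b/4) (e/2)"
    have u: "0 < u" "u < b" "u \<noteq> b/2" "\<bar>u - b/2\<bar> < e" using e b_pos by (auto simp: u_def min_def)
    have "dist (?z u) (?z (b/2)) = norm (\<i> * complex_of_real (u - b/2))"
      by (simp add: dist_norm algebra_simps)
    also have "\<dots> < e" using u unfolding norm_mult norm_of_real by simp
    finally have "dist (?z u) (?z (b/2)) < e" .
    moreover have "?z u \<noteq> ?z (b/2)" using u by (simp add: complex_eq_iff)
    ultimately show "\<exists>x'\<in>?z ` {0<..<b}. x' \<noteq> ?z (b/2) \<and> dist x' (?z (b/2)) < e"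
      using u by (intro bexI[of _ "?z u"] imageI) auto
  qed
  have sub: "?z ` {0<..<b} \<subseteq> - range w" by (intro image_subsetI) (use z in blast)
  have mid: "?z (b/2) \<in> - range w" using z by blast
  have zero: "wp z = 0" if "z \<in> - range w" for z
    by (rule analytic_continuation[OF wp_holomorphic open_complement_lattice connected_complement_lattice sub mid lim _ that])
       (use wp0 in auto)
  have "eventually (\<lambda>z. False) (at (0::complex))"
    using eventually_wp_nonzero eventually_near_0
    by eventually_elim (use near_0_notin zero in blast)
  thus False by (simp add: trivial_limit_def[symmetric])
qed

end

section \<open>Existence of the lattice\<close>

text \<open>Up to scaling every rectangular lattice has half-periods 1 and \<open>\<i> * y\<close>;
  the Eisenstein sums are now viewed as functions of the shape \<open>y\<close>.\<close>

definition lsum :: "nat \<Rightarrow> real \<Rightarrow> complex" where "lsum k y = rect_lattice.S 1 y k"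

definition lpt :: "real \<Rightarrow> int \<times> int \<Rightarrow> complex" where "lpt y = rect_lattice.w 1 y"

lemma rect_lattice_1: "0 < y \<Longrightarrow> rect_lattice 1 y"
  by unfold_locales auto

lemma lpt_Re_Im:
  assumes "0 < y"
  shows "Re (lpt y q) = 2 * of_int (fst q)" "Im (lpt y q) = 2 * of_int (snd q) * y"
  using rect_lattice.Re_w[OF rect_lattice_1[OF assms], of q] rect_lattice.Im_w[OF rect_lattice_1[OF assms], of q]
  by (simp_all add: lpt_def)

lemma lsum_eq: "0 < y \<Longrightarrow> lsum k y = (\<Sum>\<^sub>\<infinity>q. 1 / lpt y q ^ k)"
  using rect_lattice.S_def[OF rect_lattice_1, of y k] by (simp add: lsum_def lpt_def)

lemma lpt_eq_0_iff: "0 < y \<Longrightarrow> lpt y q = 0 \<longleftrightarrow> q = 0"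
  using rect_lattice.w_eq_0_iff[OF rect_lattice_1] by (simp add: lpt_def)

lemma norm_lpt_mono:
  assumes "0 < c" "c \<le> y"
  shows "norm (lpt c q) \<le> norm (lpt y q)"
proof -
  have "(2 * real_of_int (snd q) * c)\<^sup>2 \<le> (2 * real_of_int (snd q) * y)\<^sup>2"
    unfolding power_mult_distrib using assms by (intro mult_left_mono power_mono) auto
  thus ?thesis using assms by (simp add: cmod_def lpt_Re_Im)
qed

lemma norm_one_over_lpt_le:
  assumes "0 < c" "c \<le> y"
  shows "norm (1 / lpt y q ^ k) \<le> 1 / norm (lpt c q) ^ k"
proof (cases "q = 0")
  case True
  thus ?thesis using lpt_eq_0_iff[of y 0] lpt_eq_0_iff[of c 0] assms by (simp add: norm_divide norm_power)
next
  case False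
  hence "norm (lpt c q) > 0" using lpt_eq_0_iff assms by auto
  thus ?thesis using norm_lpt_mono[OF assms, of q]
    by (auto simp: norm_divide norm_power intro!: divide_left_mono power_mono mult_pos_pos zero_less_power)
qed

text \<open>Lattice points move away from the origin as \<open>y\<close> grows, so the sum for
  \<open>c = y / 2\<close> majorises all those for larger shapes and convergence is uniform near
  \<open>y\<close>.\<close>

lemma continuous_on_lsum:
  assumes k: "3 \<le> k"
  shows "continuous_on {0<..} (lsum k)"
proof -
  have "isCont (lsum k) y" if y: "y > 0" for y
  proof -
    define c where "c = y / 2"
    have c: "0 < c" "c < y" using y by (auto simp: c_def)
    have ul: "uniform_limit {c..} (\<lambda>X y. \<Sum>q\<in>X. 1 / lpt y q ^ k) (\<lambda>y. \<Sum>\<^sub>\<infinity>q. 1 / lpt y q ^ k) (finite_subsets_at_top UNIV)"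
    proof (rule Weierstrass_m_test_general)
      show "(\<lambda>q. 1 / norm (lpt c q) ^ k) summable_on UNIV"
        unfolding lpt_def by (rule rect_lattice.summable_norm_w[OF rect_lattice_1 k]) (use c in auto)
    qed (use c norm_one_over_lpt_le in auto)
    have "continuous_on {c..} (\<lambda>y. \<Sum>q\<in>X. 1 / lpt y q ^ k)" for X
    proof (rule continuous_on_sum)
      fix q
      show "continuous_on {c..} (\<lambda>y. 1 / lpt y q ^ k)"
      proof (cases "q = 0")
        case True
        hence "lpt y q = 0" if "c \<le> y" for y using that c lpt_eq_0_iff[of y q] by simp
        hence "continuous_on {c..} (\<lambda>y. 1 / lpt y q ^ k) \<longleftrightarrow> continuous_on {c..} (\<lambda>y. 1 / 0 ^ k :: complex)"
          by (intro continuous_on_cong) auto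
        thus ?thesis by simp
      next
        case False
        have "continuous_on {c..} (\<lambda>y. of_real (2 * of_int (fst q)) + \<i> * of_real (2 * of_int (snd q) * y) :: complex)"
          by (intro continuous_intros)
        moreover have "of_real (2 * of_int (fst q)) + \<i> * of_real (2 * of_int (snd q) * y) = lpt y q" if "c \<le> y" for y
          using that c by (simp add: complex_eq_iff lpt_Re_Im)
        ultimately have "continuous_on {c..} (\<lambda>y. lpt y q)"
          by (subst continuous_on_cong[OF refl, of "{c..}" _ "\<lambda>y. of_real (2 * of_int (fst q)) + \<i> * of_real (2 * of_int (snd q) * y)"]) auto
        moreover have "lpt y q \<noteq> 0" if "c \<le> y" for y using that c False lpt_eq_0_iff[of y q] by simp
        ultimately show ?thesis by (intro continuous_intros) auto
      qed
    qed
    hence "continuous_on {c..} (\<lambda>y. \<Sum>\<^sub>\<infinity>q. 1 / lpt y q ^ k)"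
      by (intro uniform_limit_theorem[OF _ ul] always_eventually) auto
    hence "continuous_on {c..} (lsum k)"
      by (rule continuous_on_cong[THEN iffD1, rotated 2]) (use c in \<open>auto simp: lsum_eq\<close>)
    thus ?thesis using c by (intro continuous_on_interior) auto
  qed
  thus ?thesis by (intro continuous_at_imp_continuous_on) auto
qed

text \<open>Multiplication by \<open>\<i> * y\<close> rotates and scales the lattice of shape
  \<open>1 / y\<close> onto that of shape \<open>y\<close>.\<close>

lemma lsum_inverse:
  assumes y: "0 < y"
  shows "lsum k (1 / y) = (\<i> * of_real y) ^ k * lsum k y"
proof -
  have "lsum k (1 / y) = (\<Sum>\<^sub>\<infinity>q. (\<i> * of_real y) ^ k * (1 / lpt y q ^ k))"
    unfolding lsum_eq[OF divide_pos_pos[OF zero_less_one y]]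
  proof (rule infsum_reindex_bij_witness[where i = "\<lambda>q. (snd q, - fst q)" and j = "\<lambda>q. (- snd q, fst q)"])
    fix q
    have "lpt y (- snd q, fst q) = (\<i> * of_real y) * lpt (1 / y) q"
      using y by (simp add: complex_eq_iff lpt_Re_Im)
    thus "(\<i> * of_real y) ^ k * (1 / lpt y (- snd q, fst q) ^ k) = 1 / lpt (1 / y) q ^ k"
      using y by (simp add: power_mult_distrib)
  qed auto
  thus ?thesis using y by (simp only: infsum_cmult_right' lsum_eq)
qed

lemma has_sum_int_even:
  fixes f :: "int \<Rightarrow> real"
  assumes "(\<lambda>n. f (int (Suc n))) sums s" and "\<And>n. 0 \<le> f n" and even: "\<And>n. f (- n) = f n" and "f 0 = 0"
  shows "(f has_sum (2 * s)) UNIV"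
proof -
  have 1: "((\<lambda>n. f (int (Suc n))) has_sum s) UNIV"
    using assms by (intro sums_nonneg_imp_has_sum) auto
  have pos: "(f has_sum s) {0<..}"
    by (rule has_sum_reindex_bij_witness[where i = "\<lambda>m. nat m - 1" and j = "\<lambda>n. int (Suc n)", THEN iffD1, OF _ _ _ _ _ _ 1]) auto
  have neg: "(f has_sum s) {..<0}"
    by (rule has_sum_reindex_bij_witness[where i = uminus and j = uminus, THEN iffD1, OF _ _ _ _ _ _ pos]) (auto simp: even)
  have "(f has_sum (s + s)) ({0<..} \<union> {..<0})" by (rule has_sum_Un_disjoint[OF pos neg]) auto
  hence "(f has_sum (f 0 + (s + s))) (insert 0 ({0<..} \<union> {..<0}))" by (intro has_sum_insert) auto
  also have "insert 0 ({0<..} \<union> {..<0}) = (UNIV :: int set)" by auto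
  finally show ?thesis using assms(4) by simp
qed

lemma lsum_axis:
  assumes k: "even k" "3 \<le> k" and s: "(\<lambda>n. 1 / real (Suc n) ^ k) sums s" and y: "0 < y"
  shows "((\<lambda>q. 1 / lpt y q ^ k) has_sum of_real (2 * s / 2 ^ k)) {q. snd q = 0}"
proof -
  have "((\<lambda>n::int. 1 / real_of_int n ^ k) has_sum (2 * s)) UNIV"
    using s k by (intro has_sum_int_even) (auto simp: power_0_left add.commute)
  hence "((\<lambda>n::int. 1 / 2 ^ k * (1 / real_of_int n ^ k)) has_sum (1 / 2 ^ k * (2 * s))) UNIV"
    by (rule has_sum_cmult_right)
  hence "((\<lambda>n::int. complex_of_real (1 / 2 ^ k * (1 / real_of_int n ^ k))) has_sum of_real (1 / 2 ^ k * (2 * s))) UNIV"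
    by (rule has_sum_of_real)
  hence 1: "((\<lambda>n::int. complex_of_real (1 / 2 ^ k * (1 / real_of_int n ^ k))) has_sum of_real (2 * s / 2 ^ k)) UNIV"
    by simp
  show ?thesis
  proof (rule has_sum_reindex_bij_witness[where i = fst and j = "\<lambda>n. (n, 0)", THEN iffD1, OF _ _ _ _ _ _ 1])
    fix n :: int
    have "lpt y (n, 0) = of_real (2 * real_of_int n)" using y by (simp add: complex_eq_iff lpt_Re_Im)
    thus "1 / lpt y (n, 0) ^ k = complex_of_real (1 / 2 ^ k * (1 / real_of_int n ^ k))"
      by (simp add: power_mult_distrib)
  qed auto
qed

text \<open>As \<open>y\<close> grows only the real row survives, which is \<open>2 / 2^k\<close>
  times the zeta value. Off this row one of the \<open>k\<close> factors of the norm is at least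
  \<open>y\<close>, and the other \<open>k - 1\<close> are at least their values for shape 1; those
  are summable because \<open>k - 1 \<ge> 3\<close>.\<close>

lemma tendsto_lsum:
  assumes k: "even k" "4 \<le> k" and s: "(\<lambda>n. 1 / real (Suc n) ^ k) sums s"
  shows "(lsum k \<longlongrightarrow> of_real (2 * s / 2 ^ k)) at_top"
proof -
  define C where "C = (\<Sum>\<^sub>\<infinity>q\<in>{q. snd q \<noteq> 0}. 1 / norm (lpt 1 q) ^ (k - 1))"
  have C: "((\<lambda>q. 1 / norm (lpt 1 q) ^ (k - 1)) has_sum C) {q. snd q \<noteq> 0}"
    unfolding C_def lpt_def
    by (rule has_sum_infsum, rule rect_lattice.summable_norm_w[OF rect_lattice_1]) (use k in auto)
  have bound: "norm (lsum k y - of_real (2 * s / 2 ^ k)) \<le> 1 / y * C" if y: "1 \<le> y" for y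
  proof -
    have y0: "y > 0" using y by simp
    have "(\<lambda>q. 1 / lpt y q ^ k) summable_on UNIV"
      unfolding lpt_def by (rule rect_lattice.summable_w[OF rect_lattice_1]) (use y k in auto)
    hence "((\<lambda>q. 1 / lpt y q ^ k) has_sum lsum k y) UNIV" by (simp add: lsum_eq y0)
    from has_sum_Diff[OF this lsum_axis[OF k(1) _ s y0]] k
    have "((\<lambda>q. 1 / lpt y q ^ k) has_sum (lsum k y - of_real (2 * s / 2 ^ k))) (UNIV - {q. snd q = 0})" by simp
    also have "UNIV - {q :: int \<times> int. snd q = 0} = {q. snd q \<noteq> 0}" by auto
    finally have 1: "((\<lambda>q. 1 / lpt y q ^ k) has_sum (lsum k y - of_real (2 * s / 2 ^ k))) {q. snd q \<noteq> 0}" .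
    show ?thesis
    proof (rule norm_infsum_le[OF 1 has_sum_cmult_right[OF C]])
      fix q :: "int \<times> int" assume "q \<in> {q. snd q \<noteq> 0}"
      hence q: "snd q \<noteq> 0" by simp
      hence pos: "norm (lpt 1 q) > 0" using lpt_eq_0_iff[of 1 q] by auto
      have "y * 1 \<le> y * \<bar>real_of_int (snd q)\<bar>" using q y by (intro mult_left_mono) auto
      also have "\<dots> \<le> \<bar>Im (lpt y q)\<bar>" using y0 by (simp add: lpt_Re_Im abs_mult mult.commute)
      also have "\<dots> \<le> norm (lpt y q)" by (rule abs_Im_le_cmod)
      finally have "y \<le> norm (lpt y q)" by simp
      moreover have "norm (lpt 1 q) ^ (k - 1) \<le> norm (lpt y q) ^ (k - 1)"
        using norm_lpt_mono[of 1 y q] y by (intro power_mono) auto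
      ultimately have "y * norm (lpt 1 q) ^ (k - 1) \<le> norm (lpt y q) * norm (lpt y q) ^ (k - 1)"
        using y0 by (intro mult_mono) auto
      also have "\<dots> = norm (lpt y q) ^ k" using k by (simp flip: power_Suc)
      finally have "1 / norm (lpt y q) ^ k \<le> 1 / (y * norm (lpt 1 q) ^ (k - 1))"
        using y0 pos norm_lpt_mono[of 1 y q] y by (intro divide_left_mono mult_pos_pos zero_less_power) auto
      thus "norm (1 / lpt y q ^ k) \<le> 1 / y * (1 / norm (lpt 1 q) ^ (k - 1))"
        by (simp add: norm_divide norm_power)
    qed
  qed
  have "((\<lambda>y. lsum k y - of_real (2 * s / 2 ^ k)) \<longlongrightarrow> 0) at_top"
  proof (rule Lim_null_comparison)
    show "eventually (\<lambda>y. norm (lsum k y - of_real (2 * s / 2 ^ k)) \<le> 1 / y * C) at_top"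
      using eventually_ge_at_top[of 1] by eventually_elim (rule bound)
    show "((\<lambda>y. 1 / y * C) \<longlongrightarrow> 0) at_top"
      by (intro tendsto_mult_left_zero tendsto_divide_0[OF tendsto_const] filterlim_at_top_imp_at_infinity filterlim_ident)
  qed
  thus ?thesis by (rule LIM_zero_cancel)
qed

lemma lattice_g2_scale: "lattice_g2 (c * w1) (c * w2) = lattice_g2 w1 w2 / c ^ 4"
proof -
  have "1 / (2 * of_int m * (c * w1) + 2 * of_int n * (c * w2)) ^ 4
      = 1 / c ^ 4 * (1 / (2 * of_int m * w1 + 2 * of_int n * w2) ^ 4)" for m n :: int
  proof -
    have "2 * of_int m * (c * w1) + 2 * of_int n * (c * w2) = c * (2 * of_int m * w1 + 2 * of_int n * w2)"
      by (simp add: algebra_simps)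
    thus ?thesis by (simp add: power_mult_distrib)
  qed
  thus ?thesis unfolding lattice_g2_def case_prod_unfold by (simp only: infsum_cmult_right') simp
qed

lemma lattice_g3_scale: "lattice_g3 (c * w1) (c * w2) = lattice_g3 w1 w2 / c ^ 6"
proof -
  have "1 / (2 * of_int m * (c * w1) + 2 * of_int n * (c * w2)) ^ 6
      = 1 / c ^ 6 * (1 / (2 * of_int m * w1 + 2 * of_int n * w2) ^ 6)" for m n :: int
  proof -
    have "2 * of_int m * (c * w1) + 2 * of_int n * (c * w2) = c * (2 * of_int m * w1 + 2 * of_int n * w2)"
      by (simp add: algebra_simps)
    thus ?thesis by (simp add: power_mult_distrib)
  qed
  thus ?thesis unfolding lattice_g3_def case_prod_unfold by (simp only: infsum_cmult_right') simp
qed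

text \<open>The ratio \<open>D\<close> is invariant under scaling and so depends on the shape alone.
  The hypothesis \<open>disc\<close> says that its prescribed value lies strictly between the limits
  \<open>- L\<close> and \<open>L\<close> of \<open>D\<close> as the shape tends to 0 and to
  infinity.\<close>

lemma rectangular_lattice_exists:
  fixes G2 G3 :: real
  assumes G2: "0 < G2" and disc: "27 * G3\<^sup>2 < G2 ^ 3"
  shows "\<exists>\<Omega> t. 0 < \<Omega> \<and> 0 < t \<and> lattice_g2 (of_real \<Omega>) (\<i> * of_real t) = of_real G2 \<and>
      lattice_g3 (of_real \<Omega>) (\<i> * of_real t) = of_real G3"
proof -
  define A where "A y = 60 * Re (lsum 4 y)" for y
  define B where "B y = 140 * Re (lsum 6 y)" for y
  have real: "lsum k y = of_real (Re (lsum k y))" if "0 < y" for k y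
    unfolding lsum_def by (rule rect_lattice.S_real[OF rect_lattice_1[OF that]])
  have g2: "lattice_g2 (of_real 1) (\<i> * of_real y) = of_real (A y)" if "0 < y" for y
    using rect_lattice.lattice_g2_eq[OF rect_lattice_1[OF that]] real[OF that, of 4] by (simp add: A_def lsum_def)
  have g3: "lattice_g3 (of_real 1) (\<i> * of_real y) = of_real (B y)" if "0 < y" for y
    using rect_lattice.lattice_g3_eq[OF rect_lattice_1[OF that]] real[OF that, of 6] by (simp add: B_def lsum_def)
  have A_pos: "A y > 0" if "0 < y" for y
    using rect_lattice.S4_pos[OF rect_lattice_1[OF that]] by (simp add: A_def lsum_def)
  have i4: "\<i> ^ 4 = 1" and i6: "\<i> ^ 6 = - 1" by (simp_all add: power_numeral_reduce)
  have A_inv: "A (1 / y) = y ^ 4 * A y" and B_inv: "B (1 / y) = - (y ^ 6 * B y)" if "0 < y" for y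
    using lsum_inverse[OF that, of 4] lsum_inverse[OF that, of 6]
    by (simp_all add: A_def B_def power_mult_distrib i4 i6 flip: of_real_power)
  define D where "D y = B y / sqrt (A y) ^ 3" for y
  have "continuous_on {0<..} A" "continuous_on {0<..} B"
    unfolding A_def B_def by (intro continuous_intros continuous_on_lsum; simp)+
  hence D_cont: "continuous_on {0<..} D"
    unfolding D_def using A_pos by (intro continuous_intros) force+
  have D_inv: "D (1 / y) = - D y" if y: "0 < y" for y
  proof -
    have "sqrt (A (1 / y)) = sqrt ((y\<^sup>2)\<^sup>2 * A y)" by (simp add: A_inv[OF y] flip: power_mult)
    also have "\<dots> = y\<^sup>2 * sqrt (A y)" by (simp only: real_sqrt_mult real_sqrt_abs abs_power2)
    finally have "sqrt (A (1 / y)) ^ 3 = y ^ 6 * sqrt (A y) ^ 3" by (simp add: power_mult_distrib flip: power_mult)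
    thus ?thesis using y by (simp add: D_def B_inv)
  qed
  have lim: "(D \<longlongrightarrow> (pi ^ 6 / 216) / sqrt (pi ^ 4 / 12) ^ 3) at_top"
  proof -
    have "(A \<longlongrightarrow> 60 * Re (of_real (2 * (pi ^ 4 / 90) / 2 ^ 4))) at_top"
      unfolding A_def by (intro tendsto_intros tendsto_lsum zeta_4_sums) auto
    moreover have "(B \<longlongrightarrow> 140 * Re (of_real (2 * (pi ^ 6 / 945) / 2 ^ 6))) at_top"
      unfolding B_def by (intro tendsto_intros tendsto_lsum zeta_6_sums) auto
    ultimately have "(A \<longlongrightarrow> pi ^ 4 / 12) at_top" "(B \<longlongrightarrow> pi ^ 6 / 216) at_top" by simp_all
    thus ?thesis unfolding D_def by (intro tendsto_intros) auto
  qed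
  define L where "L = (pi ^ 6 / 216) / sqrt (pi ^ 4 / 12) ^ 3"
  define \<rho> where "\<rho> = G3 / sqrt G2 ^ 3"
  \<comment> \<open>In the limit the lattice degenerates to a single row, and the discriminant
    \<open>g2^3 - 27 g3^2\<close> vanishes.\<close>
  have "L\<^sup>2 = 1 / 27"
  proof -
    have "(sqrt (pi ^ 4 / 12) ^ 3)\<^sup>2 = ((sqrt (pi ^ 4 / 12))\<^sup>2) ^ 3"
      by (simp only: power_mult[symmetric]) simp
    also have "\<dots> = (pi ^ 4 / 12) ^ 3" by (subst real_sqrt_pow2) auto
    finally show ?thesis by (simp add: L_def power_divide flip: power_mult)
  qed
  moreover have "\<rho>\<^sup>2 < 1 / 27"
  proof -
    have "(sqrt G2 ^ 3)\<^sup>2 = ((sqrt G2)\<^sup>2) ^ 3" by (simp only: power_mult[symmetric]) simp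
    also have "\<dots> = G2 ^ 3" using G2 by simp
    finally show ?thesis using disc G2 by (simp add: \<rho>_def power_divide field_simps)
  qed
  ultimately have "\<bar>\<rho>\<bar>\<^sup>2 < L\<^sup>2" by simp
  hence "\<bar>\<rho>\<bar> < L" by (rule power2_less_imp_less) (simp add: L_def)
  hence "eventually (\<lambda>y. \<bar>\<rho>\<bar> < D y \<and> 1 \<le> y) at_top"
    using order_tendstoD(1)[OF lim, of "\<bar>\<rho>\<bar>"] eventually_ge_at_top[of 1] unfolding L_def
    by (auto intro: eventually_conj)
  then obtain Y where Y: "\<bar>\<rho>\<bar> < D Y" "1 \<le> Y" by (auto simp: eventually_at_top_linorder)
  have "\<exists>y\<ge>1 / Y. y \<le> Y \<and> D y = \<rho>"
  proof (rule IVT')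
    show "D (1 / Y) \<le> \<rho>" using D_inv[of Y] Y by simp
    show "\<rho> \<le> D Y" using Y by simp
    show "1 / Y \<le> Y" using Y by (intro order_trans[of "1 / Y" 1 Y]) auto
    show "continuous_on {1 / Y..Y} D"
      by (rule continuous_on_subset[OF D_cont]) (use Y in \<open>auto intro: less_le_trans[of 0 "1 / Y"]\<close>)
  qed
  then obtain y where "1 / Y \<le> y" and D: "D y = \<rho>" by blast
  moreover have "0 < 1 / Y" using Y by simp
  ultimately have y: "0 < y" by linarith
  \<comment> \<open>With the shape fixed, \<open>c\<close> is the scaling that gives the right
    \<open>G2\<close>, as a fourth root of the ratio; \<open>D y = \<rho>\<close> then forces the
    right \<open>G3\<close>.\<close>
  define c where "c = sqrt (sqrt (A y / G2))"
  have c: "c > 0" using A_pos[OF y] G2 by (simp add: c_def)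
  have "c\<^sup>2 = sqrt (A y / G2)"
    unfolding c_def by (rule real_sqrt_pow2) (use A_pos[OF y] G2 in auto)
  hence c2: "c\<^sup>2 = sqrt (A y) / sqrt G2" by (simp only: real_sqrt_divide)
  have "c ^ 4 = (c\<^sup>2)\<^sup>2" by (simp flip: power_mult)
  also have "\<dots> = A y / G2" unfolding c2 using A_pos[OF y] G2 by (simp add: power_divide)
  finally have c4: "c ^ 4 = A y / G2" .
  have "c ^ 6 = (c\<^sup>2) ^ 3" by (simp flip: power_mult)
  also have "\<dots> = sqrt (A y) ^ 3 / sqrt G2 ^ 3" by (simp add: c2 power_divide)
  finally have c6: "c ^ 6 = sqrt (A y) ^ 3 / sqrt G2 ^ 3" .
  have "A y / c ^ 4 = G2" unfolding c4 using A_pos[OF y] G2 by simp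
  hence e2: "lattice_g2 (of_real c * of_real 1) (of_real c * (\<i> * of_real y)) = of_real G2"
    unfolding lattice_g2_scale g2[OF y] by (metis of_real_divide of_real_power)
  have "B y / c ^ 6 = G3"
    unfolding c6 using D A_pos[OF y] G2 by (simp add: D_def \<rho>_def field_simps)
  hence e3: "lattice_g3 (of_real c * of_real 1) (of_real c * (\<i> * of_real y)) = of_real G3"
    unfolding lattice_g3_scale g3[OF y] by (metis of_real_divide of_real_power)
  have "complex_of_real c * of_real 1 = of_real c" "complex_of_real c * (\<i> * of_real y) = \<i> * of_real (c * y)"
    by simp_all
  thus ?thesis using e2 e3 c y by (metis mult_pos_pos)
qed

theorem theorem9:
  fixes \<kappa> :: real
  assumes "0 < \<kappa>" and "\<kappa> < 1"
  defines "lam \<equiv> sqrt (1 - \<kappa>^2)"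
    and "G2 \<equiv> 48 * (1 + 8 * \<kappa>^2)"
    and "G3 \<equiv> 64 * (1 - 20 * \<kappa>^2 - 8 * \<kappa>^4)"
  shows "(\<exists>\<Omega> t :: real. 0 < \<Omega> \<and> 0 < t \<and>
            lattice_g2 (complex_of_real \<Omega>) (\<i> * complex_of_real t) = complex_of_real G2 \<and>
            lattice_g3 (complex_of_real \<Omega>) (\<i> * complex_of_real t) = complex_of_real G3)
       \<and> (\<forall>(\<Omega>::real) (\<Omega>'::complex). 0 < \<Omega> \<and> Re \<Omega>' = 0 \<and> 0 < Im \<Omega>' \<and>
            lattice_g2 (complex_of_real \<Omega>) \<Omega>' = complex_of_real G2 \<and>
            lattice_g3 (complex_of_real \<Omega>) \<Omega>' = complex_of_real G3 \<longrightarrow>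
            \<Omega>' = \<i> * complex_of_real (1 / (6 * sqrt 2) * pi * hyp2F1 (1/3) (2/3) 1 (lam^2)))"
proof (intro conjI allI impI)
  define x where "x = 1 - \<kappa>\<^sup>2"
  have "\<kappa>\<^sup>2 < 1\<^sup>2" using assms(1,2) by (intro power_strict_mono) auto
  hence k2: "0 < \<kappa>\<^sup>2" "\<kappa>\<^sup>2 < 1" using assms(1) by auto
  hence x: "0 < x" "x < 1" by (auto simp: x_def)
  have k4: "\<kappa> ^ 4 = (\<kappa>\<^sup>2)\<^sup>2" by (simp flip: power_mult)
  \<comment> \<open>Since \<open>48^3 = 27 * 64^2\<close>, a common factor comes out and
    \<open>(1 + 8 k)^3 - (1 - 20 k - 8 k^2)^2 = 64 k (1 - k)^3\<close> for
    \<open>k = \<kappa>^2\<close>. The constant is \<open>48^3 * 64\<close>.\<close>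
  have "27 * G3\<^sup>2 = G2 ^ 3 - 7077888 * \<kappa>\<^sup>2 * (1 - \<kappa>\<^sup>2) ^ 3"
    unfolding G2_def G3_def k4 by (simp add: algebra_simps power2_eq_square power3_eq_cube)
  moreover have "0 < 7077888 * \<kappa>\<^sup>2 * (1 - \<kappa>\<^sup>2) ^ 3"
    using k2 assms(1) by (intro mult_pos_pos zero_less_power) auto
  ultimately have "27 * G3\<^sup>2 < G2 ^ 3" by linarith
  moreover have "0 < G2" by (simp add: G2_def add_pos_nonneg)
  ultimately show "\<exists>\<Omega> t :: real. 0 < \<Omega> \<and> 0 < t \<and>
            lattice_g2 (complex_of_real \<Omega>) (\<i> * complex_of_real t) = complex_of_real G2 \<and>
            lattice_g3 (complex_of_real \<Omega>) (\<i> * complex_of_real t) = complex_of_real G3"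
    by (intro rectangular_lattice_exists)
  fix \<Omega> :: real and \<Omega>' :: complex
  assume *: "0 < \<Omega> \<and> Re \<Omega>' = 0 \<and> 0 < Im \<Omega>' \<and>
            lattice_g2 (complex_of_real \<Omega>) \<Omega>' = complex_of_real G2 \<and>
            lattice_g3 (complex_of_real \<Omega>) \<Omega>' = complex_of_real G3"
  define t where "t = Im \<Omega>'"
  have \<Omega>': "\<Omega>' = \<i> * of_real t" using * by (simp add: complex_eq_iff t_def)
  interpret rect_lattice \<Omega> t using * by unfold_locales (auto simp: t_def)
  have "G2 = 48 * (9 - 8 * x)" "G3 = 64 * (36 * x - 27 - 8 * x\<^sup>2)"
    unfolding G2_def G3_def x_def k4 by (simp_all add: algebra_simps power2_eq_square)
  hence "t = pi / (6 * sqrt 2) * hyp2F1 (1/3) (2/3) 1 x"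
    using * by (intro imaginary_half_period x) (simp_all only: \<Omega>')
  moreover have "lam\<^sup>2 = x" using x by (simp add: lam_def x_def)
  ultimately show "\<Omega>' = \<i> * complex_of_real (1 / (6 * sqrt 2) * pi * hyp2F1 (1/3) (2/3) 1 (lam^2))"
    by (simp add: \<Omega>')
qed

end
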